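(* Let $n\ge 2$ and $1 \leq a_1 \leq \cdots \leq a_n$ be integers, and let $e = \#E(K_{a_1, \ldots, a_{n-1}})$ be the number of edges of the complete multipartite graph $K_{a_1,\ldots,a_{n-1}}$. If $a_1 + \cdots + a_{n-1} > 6$ and $a_n \geq e$, then \[ \left|\mathcal{F}(K_{a_1, \ldots, a_n})\right| = \left|\mathcal{F}(K_{a_1, \ldots, a_{n-1}, e})\right|. \]
   Context: All graphs are finite, undirected and simple, and are considered up to isomorphism. $K_{a_1,\ldots,a_n}$ denotes the complete multipartite graph whose vertex set is partitioned into parts of sizes $a_1,\ldots,a_n$, with two vertices adjacent iff they lie in different parts. A Triangle-Y ($\nabla Y$) move on a graph $G$ takes a 3-cycle with vertices $a,b,c$, deletes the three edges $ab,bc,ca$, and adds a new vertex $v$ together with the edges $av,bv,cv$. A Y-Triangle ($Y\nabla$) move is the inverse operation: for a vertex $v$ of degree three whose neighbours $a,b,c$ are pairwise non-adjacent, delete $v$ (and its edges) and add the edges $ab,bc,ca$. Two graphs are cousins if one is obtained from the other by a sequence of zero or more $\nabla Y$ and $Y\nabla$ moves. The family $\mathcal{F}(G)$ of $G$ is the set of (isomorphism classes of) cousins of $G$, and $|\mathcal{F}(G)|$ is its family size. *)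

theory Defs
  imports "HOL-Library.Infinite_Typeclass"
begin

type_synonym 'a graph = "'a set \<times> 'a set set"

abbreviation verts :: "'a graph \<Rightarrow> 'a set" where "verts \<equiv> fst"
abbreviation edges :: "'a graph \<Rightarrow> 'a set set" where "edges \<equiv> snd"

definition simple_graph :: "'a graph \<Rightarrow> bool" where
  "simple_graph G \<longleftrightarrow> finite (verts G) \<and> (\<forall>e \<in> edges G. e \<subseteq> verts G \<and> card e = 2)"

definition nbrs :: "'a graph \<Rightarrow> 'a \<Rightarrow> 'a set" where
  "nbrs G v = {u. {u, v} \<in> edges G}"

definition graph_iso :: "'a graph \<Rightarrow> 'b graph \<Rightarrow> bool" (infix \<open>\<simeq>\<^sub>g\<close> 50) where
  "G \<simeq>\<^sub>g H \<longleftrightarrow> (\<exists>f. bij_betw f (verts G) (verts H) \<and> edges H = (\<lambda>e. f ` e) ` edges G)"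

definition iso_class :: "'a graph \<Rightarrow> 'a graph set" where
  "iso_class G = {H. simple_graph H \<and> G \<simeq>\<^sub>g H}"

definition complete_multipartite :: "nat list \<Rightarrow> (nat \<times> nat) graph" where
  "complete_multipartite as =
     ({(i, j). i < length as \<and> j < as ! i},
      {{(i, j), (k, l)} | i j k l.
         i < length as \<and> j < as ! i \<and> k < length as \<and> l < as ! k \<and> i \<noteq> k})"

definition triangle_Y :: "'a graph \<Rightarrow> 'a graph \<Rightarrow> bool" where
  "triangle_Y G H \<longleftrightarrow> (\<exists>a b c v.
     distinct [a, b, c] \<and> {a, b} \<in> edges G \<and> {b, c} \<in> edges G \<and> {c, a} \<in> edges G \<and>
     v \<notin> verts G \<and>
     H = (insert v (verts G),
          (edges G - {{a, b}, {b, c}, {c, a}}) \<union> {{a, v}, {b, v}, {c, v}}))"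

definition Y_triangle :: "'a graph \<Rightarrow> 'a graph \<Rightarrow> bool" where
  "Y_triangle G H \<longleftrightarrow> (\<exists>a b c v.
     v \<in> verts G \<and> distinct [a, b, c] \<and> nbrs G v = {a, b, c} \<and>
     {a, b} \<notin> edges G \<and> {b, c} \<notin> edges G \<and> {c, a} \<notin> edges G \<and>
     H = (verts G - {v},
          (edges G - {{a, v}, {b, v}, {c, v}}) \<union> {{a, b}, {b, c}, {c, a}}))"

definition cousin :: "'a graph \<Rightarrow> 'a graph \<Rightarrow> bool" where
  "cousin = (\<lambda>G H. triangle_Y G H \<or> Y_triangle G H)\<^sup>*\<^sup>*"

text \<open>The vertex type has to be infinite: otherwise a Triangle-Y move could be blocked
  for lack of a fresh vertex.\<close>

definition family :: "'a::infinite graph \<Rightarrow> 'a graph set set" where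
  "family G = iso_class ` {H. cousin G H}"


lemma simple_graph_complete_multipartite: "simple_graph (complete_multipartite as)"
proof -
  have "{(i, j). i < length as \<and> j < as ! i} = (SIGMA i:{..<length as}. {..<as ! i})"
    by auto
  then show ?thesis
    by (auto simp: simple_graph_def complete_multipartite_def card_2_iff)
qed

lemma simple_graph_edgeD:
  assumes "simple_graph G" "{x, y} \<in> edges G"
  shows "x \<in> verts G" "y \<in> verts G" "x \<noteq> y"
proof -
  have "{x, y} \<subseteq> verts G" "card {x, y} = 2" using assms unfolding simple_graph_def by blast+
  then show "x \<in> verts G" "y \<in> verts G" "x \<noteq> y" by auto
qed

lemma triangle_Y_imp_Y_triangle:
  assumes G: "simple_graph G" and "triangle_Y G H"
  shows "Y_triangle H G"
proof -
  obtain a b c v where d: "distinct [a, b, c]"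
    and e: "{a, b} \<in> edges G" "{b, c} \<in> edges G" "{c, a} \<in> edges G"
    and v: "v \<notin> verts G"
    and H: "H = (insert v (verts G),
          (edges G - {{a, b}, {b, c}, {c, a}}) \<union> {{a, v}, {b, v}, {c, v}})"
    using assms(2) unfolding triangle_Y_def by (elim exE conjE) (rule that)
  have abc: "a \<noteq> v" "b \<noteq> v" "c \<noteq> v" using simple_graph_edgeD[OF G] e v by metis+
  have nv: "{u, v} \<notin> edges G" for u using simple_graph_edgeD[OF G] v by metis
  have n: "nbrs H v = {a, b, c}"
    using nv by (auto simp: nbrs_def H doubleton_eq_iff)
  have ne: "{a, b} \<notin> edges H" "{b, c} \<notin> edges H" "{c, a} \<notin> edges H"
    using abc d by (auto simp: H doubleton_eq_iff)
  have V: "verts H - {v} = verts G" using v by (simp add: H)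
  have "edges H - {{a, v}, {b, v}, {c, v}} = edges G - {{a, b}, {b, c}, {c, a}}"
    using nv unfolding H by auto
  then have E: "(edges H - {{a, v}, {b, v}, {c, v}}) \<union> {{a, b}, {b, c}, {c, a}} = edges G"
    using e by auto
  have "v \<in> verts H" by (simp add: H)
  moreover have "G = (verts H - {v},
      (edges H - {{a, v}, {b, v}, {c, v}}) \<union> {{a, b}, {b, c}, {c, a}})"
    unfolding V E by simp
  ultimately show ?thesis using d n ne unfolding Y_triangle_def by metis
qed

lemma Y_triangle_imp_triangle_Y:
  assumes G: "simple_graph G" and "Y_triangle G H"
  shows "triangle_Y H G"
proof -
  obtain a b c v where d: "distinct [a, b, c]" and v: "v \<in> verts G"
    and n: "nbrs G v = {a, b, c}"
    and e: "{a, b} \<notin> edges G" "{b, c} \<notin> edges G" "{c, a} \<notin> edges G"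
    and H: "H = (verts G - {v},
          (edges G - {{a, v}, {b, v}, {c, v}}) \<union> {{a, b}, {b, c}, {c, a}})"
    using assms(2) unfolding Y_triangle_def by (elim exE conjE) (rule that)
  have nv: "{a, v} \<in> edges G" "{b, v} \<in> edges G" "{c, v} \<in> edges G"
    using n unfolding nbrs_def by auto
  have "edges H - {{a, b}, {b, c}, {c, a}} = edges G - {{a, v}, {b, v}, {c, v}}"
    using e unfolding H by auto
  then have E: "(edges H - {{a, b}, {b, c}, {c, a}}) \<union> {{a, v}, {b, v}, {c, v}} = edges G"
    using nv by auto
  have V: "insert v (verts H) = verts G" using v by (auto simp: H)
  have m: "{a, b} \<in> edges H" "{b, c} \<in> edges H" "{c, a} \<in> edges H" "v \<notin> verts H"
    by (auto simp: H)
  moreover have "G = (insert v (verts H),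
      (edges H - {{a, b}, {b, c}, {c, a}}) \<union> {{a, v}, {b, v}, {c, v}})"
    unfolding V E by simp
  ultimately show ?thesis using d unfolding triangle_Y_def by metis
qed

lemma simple_graph_triangle_Y:
  assumes G: "simple_graph G" and "triangle_Y G H"
  shows "simple_graph H"
proof -
  obtain a b c v where e: "{a, b} \<in> edges G" "{b, c} \<in> edges G" "{c, a} \<in> edges G"
    and v: "v \<notin> verts G"
    and H: "H = (insert v (verts G),
          (edges G - {{a, b}, {b, c}, {c, a}}) \<union> {{a, v}, {b, v}, {c, v}})"
    using assms(2) unfolding triangle_Y_def by (elim exE conjE) (rule that)
  have abc: "a \<in> verts G" "b \<in> verts G" "c \<in> verts G"
    using simple_graph_edgeD[OF G] e by metis+
  then have "a \<noteq> v" "b \<noteq> v" "c \<noteq> v" using v by auto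
  then show ?thesis using G abc unfolding H simple_graph_def by auto
qed

lemma simple_graph_Y_triangle:
  assumes G: "simple_graph G" and "Y_triangle G H"
  shows "simple_graph H"
proof -
  obtain a b c v where d: "distinct [a, b, c]"
    and n: "nbrs G v = {a, b, c}"
    and H: "H = (verts G - {v},
          (edges G - {{a, v}, {b, v}, {c, v}}) \<union> {{a, b}, {b, c}, {c, a}})"
    using assms(2) unfolding Y_triangle_def by (elim exE conjE) (rule that)
  have nv: "{a, v} \<in> edges G" "{b, v} \<in> edges G" "{c, v} \<in> edges G"
    using n unfolding nbrs_def by auto
  have abc: "a \<in> verts G" "b \<in> verts G" "c \<in> verts G" "a \<noteq> v" "b \<noteq> v" "c \<noteq> v"
    using simple_graph_edgeD[OF G] nv by metis+
  have "v \<notin> x" if x: "x \<in> edges G" "x \<notin> {{a, v}, {b, v}, {c, v}}" for x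
  proof
    assume "v \<in> x"
    moreover have "card x = 2" using x G by (simp add: simple_graph_def)
    ultimately obtain u where "x = {u, v}"
      by (auto simp: card_2_iff insert_commute)
    then show False using n x unfolding nbrs_def by auto
  qed
  then show ?thesis using G abc d unfolding H simple_graph_def by auto
qed

lemma card_edges_triangle_Y:
  assumes G: "simple_graph G" and "triangle_Y G H"
  shows "card (edges H) = card (edges G)" "verts H - \<Union>(edges H) = verts G - \<Union>(edges G)"
proof -
  obtain a b c v where d: "distinct [a, b, c]"
    and e: "{a, b} \<in> edges G" "{b, c} \<in> edges G" "{c, a} \<in> edges G"
    and v: "v \<notin> verts G"
    and H: "H = (insert v (verts G),
          (edges G - {{a, b}, {b, c}, {c, a}}) \<union> {{a, v}, {b, v}, {c, v}})"
    using assms(2) unfolding triangle_Y_def by (elim exE conjE) (rule that)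
  have fin: "finite (edges G)"
    using G finite_subset[of "edges G" "Pow (verts G)"] by (auto simp: simple_graph_def)
  have nv: "{u, v} \<notin> edges G" for u using simple_graph_edgeD[OF G] v by metis
  have abc: "a \<noteq> v" "b \<noteq> v" "c \<noteq> v" using simple_graph_edgeD[OF G] e v by metis+
  have c1: "card {{a, b}, {b, c}, {c, a}} = 3" using d by (auto simp: doubleton_eq_iff card_insert_if)
  have c2: "card {{a, v}, {b, v}, {c, v}} = 3"
    using d abc by (auto simp: doubleton_eq_iff card_insert_if)
  have "card (edges H) = card (edges G - {{a, b}, {b, c}, {c, a}}) + 3"
    unfolding H snd_conv using nv fin c2 by (subst card_Un_disjoint) auto
  also have "\<dots> = card (edges G)"
    using c1 e fin card_mono[OF fin, of "{{a, b}, {b, c}, {c, a}}"]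
    by (subst card_Diff_subset) auto
  finally show "card (edges H) = card (edges G)" .
  have "\<Union>(edges H) = insert v (\<Union>(edges G))"
  proof
    show "\<Union>(edges H) \<subseteq> insert v (\<Union>(edges G))" using e by (auto simp: H)
    have "x \<in> \<Union>(edges H)" if "x \<in> y" "y \<in> edges G" for x y
      using that by (cases "y \<in> {{a, b}, {b, c}, {c, a}}") (auto simp: H)
    then show "insert v (\<Union>(edges G)) \<subseteq> \<Union>(edges H)" by (auto simp: H)
  qed
  moreover have "v \<notin> \<Union>(edges G)" using v G by (auto simp: simple_graph_def)
  ultimately show "verts H - \<Union>(edges H) = verts G - \<Union>(edges G)"
    using v by (auto simp: H)
qed

lemma cousin_invariants:
  assumes "cousin G H" "simple_graph G"
  shows "simple_graph H \<and> card (edges H) = card (edges G) \<and>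
    verts H - \<Union>(edges H) = verts G - \<Union>(edges G)"
  using assms(1) unfolding cousin_def
proof induction
  case base
  show ?case using assms(2) by simp
next
  case (step H K)
  then show ?case
    using simple_graph_triangle_Y[of H K] simple_graph_Y_triangle[of H K]
      card_edges_triangle_Y[of H K] card_edges_triangle_Y[of K H]
      Y_triangle_imp_triangle_Y[of H K] by auto
qed

lemma cousin_sym:
  assumes "cousin G H" "simple_graph G"
  shows "cousin H G"
  using assms(1) unfolding cousin_def
proof induction
  case base
  show ?case by simp
next
  case (step H K)
  then have "simple_graph H" using cousin_invariants[of G H] assms(2) by (simp add: cousin_def)
  with step show ?case
    using triangle_Y_imp_Y_triangle Y_triangle_imp_triangle_Y
    by (metis (mono_tags, lifting) converse_rtranclp_into_rtranclp)
qed

lemma graph_iso_sym: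
  assumes "G \<simeq>\<^sub>g H" "simple_graph G"
  shows "H \<simeq>\<^sub>g G"
proof -
  obtain f where f: "bij_betw f (verts G) (verts H)" "edges H = (\<lambda>e. f ` e) ` edges G"
    using assms(1) unfolding graph_iso_def by blast
  let ?g = "inv_into (verts G) f"
  have "?g ` f ` e = e" if "e \<in> edges G" for e
    using that f(1) assms(2) unfolding simple_graph_def bij_betw_def
    by simp
  then have "(\<lambda>e. ?g ` f ` e) ` edges G = edges G" by simp
  then have "edges G = (\<lambda>e. ?g ` e) ` edges H" unfolding f(2) by (simp only: image_image)
  then show ?thesis using bij_betw_inv_into[OF f(1)] unfolding graph_iso_def by blast
qed

lemma graph_iso_trans:
  assumes "G \<simeq>\<^sub>g H" "H \<simeq>\<^sub>g K"
  shows "G \<simeq>\<^sub>g K"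
proof -
  obtain f g where f: "bij_betw f (verts G) (verts H)" "edges H = (\<lambda>e. f ` e) ` edges G"
    and g: "bij_betw g (verts H) (verts K)" "edges K = (\<lambda>e. g ` e) ` edges H"
    using assms unfolding graph_iso_def by (elim exE conjE) (rule that)
  have "edges K = (\<lambda>e. (g \<circ> f) ` e) ` edges G"
    unfolding g(2) f(2) by (simp add: image_image image_comp)
  then show ?thesis using bij_betw_trans[OF f(1) g(1)] unfolding graph_iso_def by blast
qed

lemma iso_class_eqI:
  fixes G H :: "'a graph"
  assumes "G \<simeq>\<^sub>g H" "simple_graph G"
  shows "iso_class G = iso_class H"
proof -
  have "G \<simeq>\<^sub>g K \<longleftrightarrow> H \<simeq>\<^sub>g K" for K :: "'a graph"
    using graph_iso_trans[OF assms(1), of K] graph_iso_trans[OF graph_iso_sym[OF assms], of K]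
    by (rule iffI[rotated])
  then show ?thesis by (simp add: iso_class_def)
qed

lemma finite_family:
  fixes G :: "'a::infinite graph"
  assumes G: "simple_graph G"
  shows "finite (family G)"
proof -
  define N where "N = card (verts G - \<Union>(edges G)) + 2 * card (edges G)"
  obtain S :: "'a set" where S: "finite S" "N \<le> card S"
    using arb_finite_subset[of "{} :: 'a set" N] by auto
  have "iso_class H \<in> iso_class ` (Pow S \<times> Pow (Pow S))" if "cousin G H" for H
  proof -
    have H: "simple_graph H" "card (edges H) = card (edges G)"
        "verts H - \<Union>(edges H) = verts G - \<Union>(edges G)"
      using cousin_invariants[OF that G] by auto
    have fin: "finite (verts H)" using H(1) by (simp add: simple_graph_def)
    have sub: "\<Union>(edges H) \<subseteq> verts H" using H(1) by (auto simp: simple_graph_def)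
    have "card (verts H) = card (verts H - \<Union>(edges H)) + card (\<Union>(edges H))"
      using fin sub by (simp add: card_Diff_subset finite_subset card_mono)
    also have "card (\<Union>(edges H)) \<le> (\<Sum>e\<in>edges H. card e)"
      by (rule card_Union_le_sum_card)
    also have "\<dots> = 2 * card (edges H)" using H(1) by (simp add: simple_graph_def)
    finally have "card (verts H) \<le> card S" using S H unfolding N_def by simp
    then obtain f where f: "f ` verts H \<subseteq> S" "inj_on f (verts H)"
      using card_le_inj[OF fin S(1)] by auto
    let ?K = "(f ` verts H, (\<lambda>e. f ` e) ` edges H)"
    have "H \<simeq>\<^sub>g ?K" unfolding graph_iso_def using f(2) by (auto simp: bij_betw_def)
    then have "iso_class H = iso_class ?K" using H(1) by (rule iso_class_eqI)
    moreover have "?K \<in> Pow S \<times> Pow (Pow S)" using f(1) sub by auto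
    ultimately show ?thesis by blast
  qed
  then have "family G \<subseteq> iso_class ` (Pow S \<times> Pow (Pow S))" unfolding family_def by auto
  then show ?thesis by (rule finite_subset) (simp add: S(1))
qed

end

theory Submission
  imports Defs "HOL-Combinatorics.Transposition"
begin

text \<open>
  Write the graph as the join of \<open>H = K\<^bsub>a\<^sub>1,\<dots>,a\<^sub>n\<^sub>-\<^sub>1\<^esub>\<close>, with \<open>m > 6\<close> vertices and \<open>e\<close> edges, and an
  independent set \<open>I\<close> of \<open>N \<ge> e\<close> vertices. A \<open>\<nabla>Y\<close> move lowers the degree of each corner of the
  triangle by one and uses up two of its edges, so a vertex of \<open>I\<close> keeps degree at least \<open>m/2 > 3\<close>;
  a triangle through a vertex of \<open>H\<close> uses up an edge of \<open>H\<close> there, so that vertex keeps degree at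
  least \<open>N\<close>. Hence only the vertices created by \<open>\<nabla>Y\<close> moves can be removed again, and the cousins
  are exactly the graphs obtained by replacing a set of edge-disjoint triangles by stars.

  Now enlarge \<open>I\<close> by one vertex. A packing touches at most \<open>e\<close> vertices of \<open>I\<close>, since each of them
  claims its own edge of \<open>H\<close>; so up to symmetry the new vertex is untouched and the cousins of the
  larger graph are those of the smaller one with a vertex joined to all of \<open>H\<close>. If \<open>e > m\<close>, the
  vertices of \<open>H\<close> are those of degree more than \<open>m\<close>, so isomorphisms preserve \<open>H\<close>, and adding the
  vertex neither identifies nor separates isomorphism classes. The only other cases are a star
  \<open>H\<close>, where the class depends only on the number of triangles, and an edgeless \<open>H\<close>, where no
  move is possible.
\<close>

section \<open>Triangle packings and cousins\<close>

definition pairs :: "'a set \<Rightarrow> 'a set set" where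
  "pairs T = {s. s \<subseteq> T \<and> card s = 2}"

definition packing :: "'a graph \<Rightarrow> 'a set set \<Rightarrow> bool" where
  "packing G P \<longleftrightarrow> (\<forall>T \<in> P. card T = 3 \<and> T \<subseteq> verts G \<and> pairs T \<subseteq> edges G) \<and>
     (\<forall>S \<in> P. \<forall>T \<in> P. S \<noteq> T \<longrightarrow> pairs S \<inter> pairs T = {})"

text \<open>Labels are the future star centres. They are fixed along with the packing, so that the
  result does not depend on a choice of fresh vertices at each move.\<close>

definition labelling :: "'a graph \<Rightarrow> 'a set set \<Rightarrow> ('a set \<Rightarrow> 'a) \<Rightarrow> bool" where
  "labelling G P f \<longleftrightarrow> inj_on f P \<and> f ` P \<inter> verts G = {}"

text \<open>The result of \<nabla>Y moves at all triangles of \<open>P\<close>. For edge-disjoint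
  triangles the order of the moves is irrelevant, which is why one closed form can replace a
  sequence of moves.\<close>

definition starred :: "'a graph \<Rightarrow> 'a set set \<Rightarrow> ('a set \<Rightarrow> 'a) \<Rightarrow> 'a graph" where
  "starred G P f = (verts G \<union> f ` P,
     (edges G - \<Union>(pairs ` P)) \<union> (\<Union>T \<in> P. (\<lambda>x. {x, f T}) ` T))"

lemma doubleton_in_pairs [simp]: "{x, y} \<in> pairs T \<longleftrightarrow> x \<in> T \<and> y \<in> T \<and> x \<noteq> y"
  by (auto simp: pairs_def card_insert_if)

lemma pairsE:
  assumes "s \<in> pairs T" obtains x y where "s = {x, y}" "x \<in> T" "y \<in> T" "x \<noteq> y"
  using assms by (auto simp: pairs_def card_2_iff)

lemma pairs_triple:
  assumes "distinct [a, b, c]" shows "pairs {a, b, c} = {{a, b}, {b, c}, {c, a}}"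
proof
  show "pairs {a, b, c} \<subseteq> {{a, b}, {b, c}, {c, a}}"
  proof
    fix s assume "s \<in> pairs {a, b, c}"
    then obtain x y where "s = {x, y}" "x \<in> {a, b, c}" "y \<in> {a, b, c}" "x \<noteq> y" by (rule pairsE)
    then show "s \<in> {{a, b}, {b, c}, {c, a}}" by (auto simp: insert_commute)
  qed
  show "{{a, b}, {b, c}, {c, a}} \<subseteq> pairs {a, b, c}" using assms by auto
qed

lemma pairs_image:
  assumes "inj \<psi>" shows "pairs (\<psi> ` T) = (`) \<psi> ` pairs T"
  using assms unfolding pairs_def
  by (auto simp: card_image inj_on_subset image_iff subset_image_iff)

lemma edge_doubletonE:
  assumes "simple_graph G" "s \<in> edges G"
  obtains x y where "s = {x, y}" "x \<in> verts G" "y \<in> verts G" "x \<noteq> y"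
proof -
  have "card s = 2" "s \<subseteq> verts G" using assms by (auto simp: simple_graph_def)
  then show ?thesis using that by (auto simp: card_2_iff)
qed

lemma finite_edges: "simple_graph G \<Longrightarrow> finite (edges G)"
  using finite_subset[of "edges G" "Pow (verts G)"] by (auto simp: simple_graph_def)

lemma nbrs_subset: "simple_graph G \<Longrightarrow> nbrs G v \<subseteq> verts G"
  using simple_graph_edgeD by (fastforce simp: nbrs_def)

lemma finite_nbrs: "simple_graph G \<Longrightarrow> finite (nbrs G v)"
  using nbrs_subset[of G v] finite_subset[of "nbrs G v" "verts G"] by (simp add: simple_graph_def)

lemma packingD:
  assumes "packing G P" "T \<in> P"
  shows "card T = 3" "T \<subseteq> verts G" "pairs T \<subseteq> edges G"
  using assms by (auto simp: packing_def)

lemma packing_disjoint: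
  "packing G P \<Longrightarrow> S \<in> P \<Longrightarrow> T \<in> P \<Longrightarrow> x \<in> S \<Longrightarrow> y \<in> S \<Longrightarrow> x \<in> T \<Longrightarrow> y \<in> T \<Longrightarrow> x \<noteq> y \<Longrightarrow> S = T"
  unfolding packing_def using doubleton_in_pairs[of x y S] doubleton_in_pairs[of x y T] by blast

lemma packing_subset: "packing G P \<Longrightarrow> Q \<subseteq> P \<Longrightarrow> packing G Q"
  unfolding packing_def by blast

lemma labelling_subset: "labelling G P f \<Longrightarrow> Q \<subseteq> P \<Longrightarrow> labelling G Q f"
  unfolding labelling_def by (meson inj_on_subset image_mono disjoint_iff subset_iff)

lemma finite_packing: "simple_graph G \<Longrightarrow> packing G P \<Longrightarrow> finite P"
  using finite_subset[of P "Pow (verts G)"] packingD(2)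
  by (metis PowI finite_Pow_iff simple_graph_def subsetI)

text \<open>Edge-disjointness keeps a triangle available after the moves at others.\<close>

lemma packing_pairs_remaining:
  assumes "packing G P" "T \<in> P" "Q \<subseteq> P" "T \<notin> Q"
  shows "pairs T \<subseteq> edges G - \<Union>(pairs ` Q)"
proof -
  have "pairs S \<inter> pairs T = {}" if "S \<in> Q" for S
    using assms that unfolding packing_def by (metis subsetD)
  then show ?thesis using packingD(3)[OF assms(1,2)] by blast
qed

lemma packing_insert:
  assumes "packing G P" "card T = 3" "T \<subseteq> verts G" "pairs T \<subseteq> edges G - \<Union>(pairs ` P)"
  shows "packing G (insert T P)"
  using assms unfolding packing_def by auto

lemma verts_starred [simp]: "verts (starred G P f) = verts G \<union> f ` P"
  by (simp add: starred_def)

lemma edges_starred: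
  "edges (starred G P f) = (edges G - \<Union>(pairs ` P)) \<union> (\<Union>T \<in> P. (\<lambda>x. {x, f T}) ` T)"
  by (simp add: starred_def)

lemma starred_edge_old:
  assumes "labelling G P f" "x \<in> verts G" "y \<in> verts G"
  shows "{x, y} \<in> edges (starred G P f) \<longleftrightarrow> {x, y} \<in> edges G - \<Union>(pairs ` P)"
  using assms unfolding edges_starred labelling_def by (auto simp: doubleton_eq_iff)

lemma starred_edge_new:
  assumes "simple_graph G" "packing G P" "labelling G P f" "T \<in> P"
  shows "{x, f T} \<in> edges (starred G P f) \<longleftrightarrow> x \<in> T"
proof
  have nv: "f T \<notin> verts G" using assms by (auto simp: labelling_def)
  assume "{x, f T} \<in> edges (starred G P f)"
  moreover have "{x, f T} \<notin> edges G" using nv simple_graph_edgeD[OF assms(1)] by blast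
  ultimately obtain y S where S: "S \<in> P" "y \<in> S" "{x, f T} = {y, f S}"
    unfolding edges_starred by blast
  show "x \<in> T"
  proof (cases "f T = f S")
    case True
    then have "T = S" using assms S by (auto simp: labelling_def inj_on_def)
    then show ?thesis using S by (auto simp: doubleton_eq_iff)
  next
    case False
    then have "f T \<in> S" using S by (auto simp: doubleton_eq_iff)
    then show ?thesis using packingD(2)[OF assms(2) S(1)] nv by blast
  qed
next
  assume "x \<in> T" then show "{x, f T} \<in> edges (starred G P f)" using assms unfolding edges_starred by blast
qed


lemma simple_graph_starred:
  assumes G: "simple_graph G" and P: "packing G P" and f: "labelling G P f"
  shows "simple_graph (starred G P f)"
proof -
  have "s \<subseteq> verts (starred G P f) \<and> card s = 2" if s: "s \<in> edges (starred G P f)" for s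
  proof (cases "s \<in> edges G")
    case True
    then show ?thesis using G by (auto simp: simple_graph_def)
  next
    case False
    then obtain x T where "s = {x, f T}" "T \<in> P" "x \<in> T" using s unfolding edges_starred by blast
    moreover from this have "x \<in> verts G" "f T \<notin> verts G"
      using packingD(2)[OF P] f by (auto simp: labelling_def)
    ultimately show ?thesis by (auto simp: card_insert_if)
  qed
  moreover have "finite (verts (starred G P f))"
    using G finite_packing[OF G P] by (simp add: simple_graph_def)
  ultimately show ?thesis by (simp add: simple_graph_def)
qed

section \<open>Moves between starred graphs\<close>

lemma starred_empty [simp]: "starred G {} f = G"
  by (simp add: starred_def)

text \<open>Every star edge contains a label, hence a vertex outside \<open>G\<close>, so deleting
  the edges of \<open>T\<close> leaves the stars of \<open>P\<close> intact.\<close>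

lemma starred_insert:
  assumes "T \<subseteq> verts G" "f ` P \<inter> verts G = {}"
  shows "starred G (insert T P) f = (insert (f T) (verts (starred G P f)),
    (edges (starred G P f) - pairs T) \<union> (\<lambda>x. {x, f T}) ` T)"
proof -
  have "(\<Union>S \<in> P. (\<lambda>x. {x, f S}) ` S) \<inter> pairs T = {}"
    using assms by (auto simp: disjoint_iff)
  then have "edges (starred G (insert T P) f) =
      (edges (starred G P f) - pairs T) \<union> (\<lambda>x. {x, f T}) ` T"
    unfolding edges_starred UN_insert image_insert Union_insert by blast
  then show ?thesis by (simp add: prod_eq_iff)
qed

lemma starred_cong:
  assumes "\<And>T. T \<in> P \<Longrightarrow> f T = g T" shows "starred G P f = starred G P g"
  using assms by (simp add: starred_def)

lemma card_3_distinctE: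
  assumes "card T = 3" obtains a b c where "T = {a, b, c}" "distinct [a, b, c]"
  using assms by (auto simp: card_3_iff)

lemma triangle_Y_starred_insert:
  assumes G: "simple_graph G" and P: "packing G (insert T P)" and f: "labelling G (insert T P) f"
    and T: "T \<notin> P"
  shows "triangle_Y (starred G P f) (starred G (insert T P) f)"
proof -
  obtain a b c where abc: "T = {a, b, c}" "distinct [a, b, c]"
    by (rule card_3_distinctE[OF packingD(1)[OF P insertI1]])
  have "pairs T \<subseteq> edges G - \<Union>(pairs ` P)"
    using packing_pairs_remaining[OF P _ _ T] by blast
  then have E: "pairs T \<subseteq> edges (starred G P f)" unfolding edges_starred by blast
  have v: "f T \<notin> verts (starred G P f)"
    using f T by (auto simp: labelling_def)
  have "starred G (insert T P) f = (insert (f T) (verts (starred G P f)),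
    (edges (starred G P f) - pairs T) \<union> (\<lambda>x. {x, f T}) ` T)"
    using packingD(2)[OF P, of T] f by (intro starred_insert) (auto simp: labelling_def)
  also have "\<dots> = (insert (f T) (verts (starred G P f)), (edges (starred G P f) -
      {{a, b}, {b, c}, {c, a}}) \<union> {{a, f T}, {b, f T}, {c, f T}})"
    unfolding abc(1) pairs_triple[OF abc(2)] by simp
  finally show ?thesis
    using abc(2) E v unfolding triangle_Y_def abc(1) pairs_triple[OF abc(2)] by blast
qed

lemma cousin_starred:
  assumes G: "simple_graph G" and "packing G P" "labelling G P f"
  shows "cousin G (starred G P f)"
proof -
  have "finite P" using finite_packing[OF G] assms by blast
  then show ?thesis using assms(2-3)
  proof induction
    case empty
    then show ?case by (simp add: cousin_def)
  next
    case (insert T P)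
    have "cousin G (starred G P f)"
      using insert packing_subset[of G "insert T P" P] labelling_subset[of G "insert T P" f P] by blast
    moreover have "triangle_Y (starred G P f) (starred G (insert T P) f)"
      using triangle_Y_starred_insert[OF G] insert by blast
    ultimately show ?case unfolding cousin_def by (simp add: rtranclp.rtrancl_into_rtrancl)
  qed
qed

text \<open>A star centre lies on no triangle: its neighbours are the corners of a triangle of
  \<open>P\<close>, whose mutual edges have been deleted. So every triangle of the starred graph is
  a triangle of \<open>G\<close> that shares no edge with \<open>P\<close>, and the move enlarges
  the packing.\<close>

lemma triangle_Y_starredE:
  assumes G: "simple_graph G" and P: "packing G P" and f: "labelling G P f"
    and K: "triangle_Y (starred G P f) K"
  obtains Q g where "packing G Q" "labelling G Q g" "K = starred G Q g"
proof -
  let ?S = "starred G P f"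
  obtain a b c v where d: "distinct [a, b, c]"
    and e: "{a, b} \<in> edges ?S" "{b, c} \<in> edges ?S" "{c, a} \<in> edges ?S"
    and v: "v \<notin> verts ?S"
    and K: "K = (insert v (verts ?S),
          (edges ?S - {{a, b}, {b, c}, {c, a}}) \<union> {{a, v}, {b, v}, {c, v}})"
    using K unfolding triangle_Y_def by (elim exE conjE) (rule that)
  let ?T = "{a, b, c}"
  have T3: "card ?T = 3" using d by simp
  have old: "x \<in> verts G"
    if "{y, x} \<in> edges ?S" "{z, x} \<in> edges ?S" "{y, z} \<in> edges ?S" for x y z
  proof (rule ccontr)
    assume "x \<notin> verts G"
    moreover have "x \<in> verts ?S" using simple_graph_edgeD[OF simple_graph_starred[OF G P f]] that by blast
    ultimately obtain T where T: "T \<in> P" "x = f T" by auto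
    have "y \<in> T" "z \<in> T" using that starred_edge_new[OF G P f T(1)] T by auto
    moreover have "y \<noteq> z" using simple_graph_edgeD[OF simple_graph_starred[OF G P f]] that by blast
    ultimately have "{y, z} \<in> pairs T" "y \<in> verts G" "z \<in> verts G"
      using packingD(2)[OF P T(1)] by auto
    then show False using that(3) starred_edge_old[OF f] T(1) by blast
  qed
  have V: "?T \<subseteq> verts G"
    using old[of b a c] old[of a b c] old[of a c b] e by (auto simp: insert_commute)
  have E: "pairs ?T \<subseteq> edges G - \<Union>(pairs ` P)"
    unfolding pairs_triple[OF d] using e V starred_edge_old[OF f] by blast
  have TP: "?T \<notin> P"
    using E pairs_triple[OF d] by blast
  \<comment> \<open>The old value of \<open>f\<close> at the new triangle is arbitrary; it is
    overwritten by the vertex that the move created.\<close>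
  let ?g = "f(?T := v)"
  have "packing G (insert ?T P)" using packing_insert[OF P T3 V E] .
  moreover have "labelling G (insert ?T P) ?g"
    using f v TP unfolding labelling_def verts_starred by (auto simp: inj_on_def)
  moreover have "starred G P ?g = ?S" using TP by (intro starred_cong) auto
  then have "starred G (insert ?T P) ?g = (insert v (verts ?S), (edges ?S - pairs ?T) \<union> (\<lambda>x. {x, v}) ` ?T)"
    using starred_insert[OF V, of ?g P] f TP by (auto simp: labelling_def)
  then have "K = starred G (insert ?T P) ?g" unfolding pairs_triple[OF d] K by simp
  ultimately show ?thesis by (rule that)
qed

text \<open>By the degree hypothesis the removed vertex is not in \<open>G\<close>, so it is the
  label of some triangle of \<open>P\<close>. Its removal restores that triangle.\<close>

lemma Y_triangle_starredE:
  assumes G: "simple_graph G" and P: "packing G P" and f: "labelling G P f"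
    and deg: "\<And>v. v \<in> verts G \<Longrightarrow> card (nbrs (starred G P f) v) \<noteq> 3"
    and K: "Y_triangle (starred G P f) K"
  obtains Q where "packing G Q" "labelling G Q f" "K = starred G Q f"
proof -
  let ?S = "starred G P f"
  obtain a b c v where d: "distinct [a, b, c]" and v: "v \<in> verts ?S"
    and n: "nbrs ?S v = {a, b, c}"
    and K: "K = (verts ?S - {v},
          (edges ?S - {{a, v}, {b, v}, {c, v}}) \<union> {{a, b}, {b, c}, {c, a}})"
    using K unfolding Y_triangle_def by (elim exE conjE) (rule that)
  have "card (nbrs ?S v) = 3" using n d by simp
  then obtain T where T: "T \<in> P" "v = f T" using deg v by auto
  have Tabc: "T = {a, b, c}" using n starred_edge_new[OF G P f T(1)] T(2) unfolding nbrs_def by auto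
  let ?Q = "P - {T}" let ?R = "starred G ?Q f"
  have ins: "insert T ?Q = P" using T by blast
  have Q: "packing G ?Q" "labelling G ?Q f" using packing_subset[OF P] labelling_subset[OF f] by auto
  have TQ: "pairs T \<subseteq> edges ?R"
  proof -
    have "pairs T \<subseteq> edges G - \<Union>(pairs ` ?Q)" using packing_pairs_remaining[OF P T(1)] by blast
    then show ?thesis unfolding edges_starred by blast
  qed
  have vR: "v \<notin> verts ?R" using f T by (auto simp: labelling_def inj_on_def)
  then have vE: "{x, v} \<notin> edges ?R" for x
    using simple_graph_edgeD[OF simple_graph_starred[OF G Q]] by blast
  \<comment> \<open>The starred graph is one \<nabla>Y move away from \<open>?R\<close>; the
    remaining lines undo this move.\<close>
  have S: "?S = (insert v (verts ?R), (edges ?R - pairs T) \<union> (\<lambda>x. {x, v}) ` T)"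
    using starred_insert[of T G f ?Q] packingD(2)[OF P T(1)] f T(2) unfolding ins labelling_def by auto
  have "verts K = verts ?R" using vR S unfolding K by (metis Diff_insert_absorb fst_conv)
  moreover have "edges K = (edges ?S - (\<lambda>x. {x, v}) ` T) \<union> pairs T"
    unfolding K Tabc pairs_triple[OF d] by simp
  then have "edges K = edges ?R" using TQ vE unfolding S by auto
  ultimately have "K = ?R" by (simp add: prod_eq_iff)
  then show ?thesis using that Q by blast
qed

text \<open>If no vertex of \<open>G\<close> itself can be brought down to degree three, then the only possible
  \<open>Y\<nabla>\<close> moves undo earlier \<open>\<nabla>Y\<close> moves, so the cousins are the graphs \<open>starred G P f\<close>.\<close>

lemma cousin_iff_starred:
  assumes G: "simple_graph G"
    and deg: "\<And>P f v. packing G P \<Longrightarrow> labelling G P f \<Longrightarrow> v \<in> verts G \<Longrightarrow>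
      card (nbrs (starred G P f) v) \<noteq> 3"
  shows "cousin G K \<longleftrightarrow> (\<exists>P f. packing G P \<and> labelling G P f \<and> K = starred G P f)"
proof
  assume "cousin G K"
  then show "\<exists>P f. packing G P \<and> labelling G P f \<and> K = starred G P f"
    unfolding cousin_def
  proof induction
    case base
    have "packing G {}" "labelling G {} f" for f by (auto simp: packing_def labelling_def)
    then show ?case by (metis starred_empty)
  next
    case (step H K)
    then obtain P f where P: "packing G P" "labelling G P f" "H = starred G P f" by blast
    from step.hyps(2) show ?case
    proof
      assume "triangle_Y H K"
      then show ?thesis using triangle_Y_starredE[OF G P(1,2)] P(3) by metis
    next
      assume "Y_triangle H K"
      then show ?thesis using Y_triangle_starredE[OF G P(1,2) deg[OF P(1,2)]] P(3) by metis
    qed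
  qed
qed (use cousin_starred[OF G] in blast)

section \<open>Degrees and symmetries of starred graphs\<close>

text \<open>Each packed triangle at \<open>v\<close> takes away two neighbours and gives back one
  star centre. Edge-disjoint triangles at \<open>v\<close> meet only in \<open>v\<close>, so the
  pairs taken away are disjoint and at most half the degree can be lost.\<close>

lemma card_nbrs_starred:
  assumes G: "simple_graph G" and P: "packing G P" and f: "labelling G P f" and v: "v \<in> verts G"
  shows "card (nbrs (starred G P f) v) + card {T \<in> P. v \<in> T} = card (nbrs G v)"
    and "2 * card {T \<in> P. v \<in> T} \<le> card (nbrs G v)"
proof -
  let ?Q = "{T \<in> P. v \<in> T}"
  let ?R = "\<Union>T \<in> ?Q. T - {v}"
  have finQ: "finite ?Q" using finite_packing[OF G P] by simp
  have finT: "finite T" if "T \<in> ?Q" for T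
    using packingD(1)[OF P] that card.infinite by force
  have R: "?R \<subseteq> nbrs G v"
  proof
    fix u assume "u \<in> ?R"
    then obtain T where "T \<in> P" "v \<in> T" "u \<in> T" "u \<noteq> v" by blast
    then show "u \<in> nbrs G v" using packingD(3)[OF P, of T] doubleton_in_pairs[of u v T]
      unfolding nbrs_def by blast
  qed
  have "card ?R = (\<Sum>T \<in> ?Q. card (T - {v}))"
    using finQ finT by (intro card_UN_disjoint) (auto dest: packing_disjoint[OF P, of _ _ v])
  also have "\<dots> = (\<Sum>T \<in> ?Q. 2)"
    using packingD(1)[OF P] finT by (intro sum.cong) (auto simp: card_Diff_singleton)
  finally have cR: "card ?R = 2 * card ?Q" by simp
  have "u \<in> nbrs (starred G P f) v \<longleftrightarrow> u \<in> (nbrs G v - ?R) \<union> f ` ?Q" for u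
  proof (cases "u \<in> verts G")
    case True
    have "u \<notin> f ` ?Q" using f True by (auto simp: labelling_def)
    moreover have "{u, v} \<in> \<Union>(pairs ` P) \<longleftrightarrow> u \<in> ?R" by auto
    ultimately show ?thesis using starred_edge_old[OF f True v] unfolding nbrs_def by blast
  next
    case False
    have n: "u \<notin> nbrs G v" using nbrs_subset[OF G] False by blast
    show ?thesis
    proof (cases "u \<in> f ` P")
      case True
      then obtain T where T: "T \<in> P" "u = f T" by blast
      have "f T \<in> f ` ?Q \<longleftrightarrow> v \<in> T" using f T by (auto simp: labelling_def inj_on_def)
      then show ?thesis using n T starred_edge_new[OF G P f T(1), of v]
        by (auto simp: nbrs_def insert_commute)
    next
      case F: False
      then have "u \<notin> nbrs (starred G P f) v"
        using False nbrs_subset[OF simple_graph_starred[OF G P f], of v] by auto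
      then show ?thesis using n F by blast
    qed
  qed
  then have N: "nbrs (starred G P f) v = (nbrs G v - ?R) \<union> f ` ?Q" by blast
  have "(nbrs G v - ?R) \<inter> f ` ?Q = {}"
    using nbrs_subset[OF G, of v] f by (auto simp: labelling_def)
  moreover have "card (f ` ?Q) = card ?Q"
    using f by (intro card_image) (auto simp: labelling_def inj_on_def)
  moreover have finR: "finite ?R" using finite_subset[OF R] finite_nbrs[OF G] by blast
  ultimately have "card (nbrs (starred G P f) v) = card (nbrs G v) - 2 * card ?Q + card ?Q"
    unfolding N using finQ finite_nbrs[OF G, of v] card_Diff_subset[OF finR R] cR
    by (subst card_Un_disjoint) auto
  moreover have "card ?R \<le> card (nbrs G v)" using card_mono[OF finite_nbrs[OF G] R] .
  ultimately show "card (nbrs (starred G P f) v) + card ?Q = card (nbrs G v)"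
    "2 * card ?Q \<le> card (nbrs G v)" using cR by simp_all
qed

text \<open>Counting by distinct representatives. It bounds both the number of triangles at a vertex
  of \<open>H\<close> and the number of touched vertices of \<open>I\<close>.\<close>

lemma card_le_card_if_disjoint_choices:
  assumes "finite U" "\<And>i. i \<in> J \<Longrightarrow> A i \<inter> U \<noteq> {}"
    and "\<And>i j. i \<in> J \<Longrightarrow> j \<in> J \<Longrightarrow> i \<noteq> j \<Longrightarrow> A i \<inter> A j \<inter> U = {}"
  shows "card J \<le> card U"
proof -
  have "\<forall>i \<in> J. \<exists>y. y \<in> A i \<inter> U" using assms(2) by blast
  then obtain c where c: "\<And>i. i \<in> J \<Longrightarrow> c i \<in> A i \<inter> U" by metis
  have "inj_on c J" using c assms(3) by (fastforce simp: inj_on_def)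
  then show ?thesis using c assms(1) by (intro card_inj_on_le[of c]) auto
qed

text \<open>An automorphism of \<open>G\<close>, given as a permutation of the whole vertex type,
  also acts on the labels. This one fact serves to rename labels, to exchange vertices of
  \<open>I\<close>, and to match packings of equal size in the star case.\<close>

lemma starred_permute_iso:
  assumes \<psi>: "bij \<psi>" and V: "\<psi> ` verts G = verts G" and E: "(`) \<psi> ` edges G = edges G"
    and Q: "Q = (`) \<psi> ` P" and g: "\<And>T. T \<in> P \<Longrightarrow> g (\<psi> ` T) = \<psi> (f T)"
  shows "starred G P f \<simeq>\<^sub>g starred G Q g"
    and "packing G P \<Longrightarrow> packing G Q"
    and "labelling G P f \<Longrightarrow> labelling G Q g"
proof -
  have inj: "inj \<psi>" "inj ((`) \<psi>)" using \<psi> by (auto simp: bij_def inj_on_def inj_image_eq_iff)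
  have gQ: "g ` Q = \<psi> ` f ` P" unfolding Q using g by (auto simp: image_image)
  have pQ: "\<Union>(pairs ` Q) = (`) \<psi> ` \<Union>(pairs ` P)"
    unfolding Q by (auto simp: pairs_image[OF inj(1)])
  have "(\<Union>T \<in> Q. (\<lambda>x. {x, g T}) ` T) = (`) \<psi> ` (\<Union>T \<in> P. (\<lambda>x. {x, f T}) ` T)"
    unfolding Q using g by (simp add: image_UN image_image)
  then have "edges (starred G Q g) = (`) \<psi> ` edges (starred G P f)"
    unfolding edges_starred image_Un image_set_diff[OF inj(2)] pQ E by simp
  moreover have "verts (starred G Q g) = \<psi> ` verts (starred G P f)"
    by (simp add: image_Un V gQ)
  then have "bij_betw \<psi> (verts (starred G P f)) (verts (starred G Q g))"
    using inj(1) by (auto simp: bij_betw_def inj_on_def)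
  ultimately show "starred G P f \<simeq>\<^sub>g starred G Q g" unfolding graph_iso_def by blast
  show "packing G Q" if P: "packing G P"
  proof -
    have "card (\<psi> ` T) = 3 \<and> \<psi> ` T \<subseteq> verts G \<and> pairs (\<psi> ` T) \<subseteq> edges G" if "T \<in> P" for T
    proof (intro conjI)
      show "card (\<psi> ` T) = 3" using packingD(1)[OF P that] inj(1) by (simp add: card_image inj_on_subset)
      show "\<psi> ` T \<subseteq> verts G" using packingD(2)[OF P that] V by blast
      show "pairs (\<psi> ` T) \<subseteq> edges G"
        using packingD(3)[OF P that] E unfolding pairs_image[OF inj(1)] by blast
    qed
    moreover have "pairs (\<psi> ` S) \<inter> pairs (\<psi> ` T) = {}" if "S \<in> P" "T \<in> P" "\<psi> ` S \<noteq> \<psi> ` T" for S T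
    proof -
      have "pairs S \<inter> pairs T = {}" using P that unfolding packing_def by blast
      then show ?thesis unfolding pairs_image[OF inj(1)] image_Int[OF inj(2), symmetric] by simp
    qed
    ultimately show ?thesis unfolding packing_def Q by blast
  qed
  show "labelling G Q g" if f: "labelling G P f"
  proof -
    have "inj_on g Q"
    proof (rule inj_onI)
      fix S' T' assume "S' \<in> Q" "T' \<in> Q" "g S' = g T'"
      moreover from this obtain S T where "S \<in> P" "T \<in> P" "S' = \<psi> ` S" "T' = \<psi> ` T" using Q by blast
      ultimately have "f S = f T" using g inj(1) by (simp add: inj_eq)
      then show "S' = T'"
        using f \<open>S \<in> P\<close> \<open>T \<in> P\<close> \<open>S' = \<psi> ` S\<close> \<open>T' = \<psi> ` T\<close> by (auto simp: labelling_def inj_on_def)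
    qed
    moreover have "g ` Q \<inter> verts G = \<psi> ` (f ` P \<inter> verts G)"
      unfolding gQ image_Int[OF inj(1)] V ..
    ultimately show ?thesis using f unfolding labelling_def by simp
  qed
qed

section \<open>Adding a twin vertex\<close>

lemma iso_class_eq_iff:
  fixes G K :: "'a graph"
  assumes "simple_graph G" "simple_graph K"
  shows "iso_class G = iso_class K \<longleftrightarrow> G \<simeq>\<^sub>g K"
proof
  assume "iso_class G = iso_class K"
  moreover have "K \<simeq>\<^sub>g K" unfolding graph_iso_def by (rule exI[of _ id]) auto
  ultimately show "G \<simeq>\<^sub>g K" using assms(2) unfolding iso_class_def by blast
qed (rule iso_class_eqI[OF _ assms(1)])

text \<open>Used to count two families as quotients of one common set: equal equivalence relations
  give equally many classes.\<close>

lemma card_image_eq_if_same_kernel: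
  assumes "\<And>a b. a \<in> A \<Longrightarrow> b \<in> A \<Longrightarrow> p a = p b \<longleftrightarrow> q a = q b"
  shows "card (p ` A) = card (q ` A)"
proof -
  define h where "h = q \<circ> inv_into A p"
  have hp: "h (p a) = q a" if "a \<in> A" for a
    using that assms[of "inv_into A p (p a)" a] by (simp add: h_def inv_into_into f_inv_into_f)
  have "inj_on h (p ` A)" using assms hp by (auto simp: inj_on_def)
  moreover have "h ` p ` A = q ` A" using hp by (simp add: image_image)
  ultimately show ?thesis by (metis card_image)
qed

section \<open>Degrees under isomorphism\<close>

lemma nbrs_graph_iso:
  assumes K: "simple_graph K" and \<phi>: "bij_betw \<phi> (verts K) (verts L)"
    and E: "edges L = (`) \<phi> ` edges K" and v: "v \<in> verts K"
  shows "nbrs L (\<phi> v) = \<phi> ` nbrs K v"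
proof
  show "nbrs L (\<phi> v) \<subseteq> \<phi> ` nbrs K v"
  proof
    fix w assume "w \<in> nbrs L (\<phi> v)"
    then obtain s where s: "s \<in> edges K" "\<phi> ` s = {w, \<phi> v}" unfolding nbrs_def E by force
    have sV: "s \<subseteq> verts K" using s(1) K by (auto simp: simple_graph_def)
    have "\<phi> v \<in> \<phi> ` s" using s(2) by simp
    then have vs: "v \<in> s" using \<phi> sV v by (auto simp: bij_betw_def inj_on_def)
    obtain x y where xy: "s = {x, y}" "x \<noteq> y" using edge_doubletonE[OF K s(1)] by metis
    then obtain z where z: "s = {z, v}" "z \<noteq> v" using vs by (cases "v = x") (auto simp: insert_commute)
    then have "\<phi> z \<noteq> \<phi> v" using \<phi> sV by (auto simp: bij_betw_def inj_on_def)
    then have "w = \<phi> z" using s(2) z by (auto simp: doubleton_eq_iff)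
    then show "w \<in> \<phi> ` nbrs K v" using s(1) z by (auto simp: nbrs_def)
  qed
  show "\<phi> ` nbrs K v \<subseteq> nbrs L (\<phi> v)"
  proof
    fix w assume "w \<in> \<phi> ` nbrs K v"
    then obtain z where "w = \<phi> z" "{z, v} \<in> edges K" by (auto simp: nbrs_def)
    then have "{w, \<phi> v} = \<phi> ` {z, v}" "{z, v} \<in> edges K" by auto
    then show "w \<in> nbrs L (\<phi> v)" unfolding nbrs_def E by blast
  qed
qed

lemma card_nbrs_graph_iso:
  assumes "simple_graph K" "bij_betw \<phi> (verts K) (verts L)"
    and "edges L = (`) \<phi> ` edges K" "v \<in> verts K"
  shows "card (nbrs L (\<phi> v)) = card (nbrs K v)"
  unfolding nbrs_graph_iso[OF assms]
  by (rule card_image, rule inj_on_subset[OF bij_betw_imp_inj_on[OF assms(2)] nbrs_subset[OF assms(1)]])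

lemma graph_iso_image_degree_gt:
  assumes K: "simple_graph K" and \<phi>: "bij_betw \<phi> (verts K) (verts L)"
    and E: "edges L = (`) \<phi> ` edges K"
  shows "\<phi> ` {v \<in> verts K. m < card (nbrs K v)} = {v \<in> verts L. m < card (nbrs L v)}"
proof -
  have V: "verts L = \<phi> ` verts K" using \<phi> by (simp add: bij_betw_def)
  show ?thesis unfolding V using card_nbrs_graph_iso[OF assms] by auto
qed

section \<open>Extension by a vertex with prescribed neighbourhood\<close>

definition add_vertex :: "'a \<Rightarrow> 'a set \<Rightarrow> 'a graph \<Rightarrow> 'a graph" where
  "add_vertex d X K = (insert d (verts K), edges K \<union> (\<lambda>x. {x, d}) ` X)"

lemma verts_add_vertex [simp]: "verts (add_vertex d X K) = insert d (verts K)"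
  and edges_add_vertex: "edges (add_vertex d X K) = edges K \<union> (\<lambda>x. {x, d}) ` X"
  by (simp_all add: add_vertex_def)

lemma simple_graph_add_vertex:
  assumes "simple_graph K" "X \<subseteq> verts K" "d \<notin> verts K"
  shows "simple_graph (add_vertex d X K)"
  using assms unfolding simple_graph_def edges_add_vertex by (auto simp: card_insert_if)

lemma nbrs_add_vertex_new:
  assumes "simple_graph K" "d \<notin> verts K"
  shows "nbrs (add_vertex d X K) d = X"
  using assms simple_graph_edgeD(2)[OF assms(1)] unfolding nbrs_def edges_add_vertex
  by (auto simp: doubleton_eq_iff)

text \<open>Vertices with the same neighbourhood are non-adjacent twins, and exchanging twins is an
  automorphism.\<close>

lemma transpose_twins_edges:
  assumes L: "simple_graph L" and n: "nbrs L w = nbrs L d"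
  shows "(`) (transpose w d) ` edges L = edges L"
proof -
  let ?\<tau> = "transpose w d"
  have wd: "{w, d} \<notin> edges L"
  proof
    assume "{w, d} \<in> edges L"
    then have "w \<in> nbrs L w" unfolding n by (simp add: nbrs_def)
    then have "{w, w} \<in> edges L" by (simp add: nbrs_def)
    then show False using simple_graph_edgeD(3)[OF L] by blast
  qed
  have tw: "{x, w} \<in> edges L \<longleftrightarrow> {x, d} \<in> edges L" for x using n by (auto simp: nbrs_def)
  have im: "?\<tau> ` s \<in> edges L" if s: "s \<in> edges L" for s
  proof -
    obtain x y where xy: "s = {x, y}" "x \<noteq> y" using edge_doubletonE[OF L s] by metis
    show ?thesis
    proof (cases "w \<in> s \<or> d \<in> s")
      case True
      then obtain z where z: "s = {z, w} \<or> s = {z, d}" using xy by (auto simp: insert_commute)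
      moreover have "z \<noteq> w" "z \<noteq> d"
        using z s wd simple_graph_edgeD(3)[OF L] by (metis insert_commute)+
      ultimately show ?thesis using s tw[of z] by auto
    next
      case False
      then have "?\<tau> ` s = s" by (auto simp: image_iff transpose_def)
      then show ?thesis using s by simp
    qed
  qed
  show ?thesis
  proof
    show "(`) ?\<tau> ` edges L \<subseteq> edges L" using im by blast
    show "edges L \<subseteq> (`) ?\<tau> ` edges L"
    proof
      fix s assume "s \<in> edges L"
      moreover have "s = ?\<tau> ` ?\<tau> ` s" by (simp add: image_image)
      ultimately show "s \<in> (`) ?\<tau> ` edges L" using im by blast
    qed
  qed
qed

text \<open>If isomorphisms preserve \<open>X\<close>, they extend by fixing \<open>d\<close>.
  Conversely an isomorphism of the extended graphs may move \<open>d\<close>, but its image has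
  neighbourhood \<open>X\<close>, just as \<open>d\<close> has; swapping these twins gives an
  isomorphism that fixes \<open>d\<close> and therefore restricts.\<close>

lemma add_vertex_iso_iff:
  assumes K: "simple_graph K" "X \<subseteq> verts K" "d \<notin> verts K"
    and L: "simple_graph L" "X \<subseteq> verts L" "d \<notin> verts L"
    and inv: "\<And>\<phi>. bij_betw \<phi> (verts K) (verts L) \<Longrightarrow> edges L = (`) \<phi> ` edges K \<Longrightarrow> \<phi> ` X = X"
    and inv': "\<And>\<phi>. bij_betw \<phi> (insert d (verts K)) (insert d (verts L)) \<Longrightarrow>
      edges (add_vertex d X L) = (`) \<phi> ` edges (add_vertex d X K) \<Longrightarrow> \<phi> ` X = X"
  shows "K \<simeq>\<^sub>g L \<longleftrightarrow> add_vertex d X K \<simeq>\<^sub>g add_vertex d X L"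
proof
  assume "K \<simeq>\<^sub>g L"
  then obtain \<phi> where \<phi>: "bij_betw \<phi> (verts K) (verts L)" "edges L = (`) \<phi> ` edges K"
    unfolding graph_iso_def by blast
  define \<psi> where "\<psi> = \<phi>(d := d)"
  have d: "\<psi> d = d" by (simp add: \<psi>_def)
  have old: "\<psi> ` s = \<phi> ` s" if "s \<subseteq> verts K" for s using that K(3) by (auto simp: \<psi>_def)
  have "bij_betw \<psi> (verts K) (verts L)"
    by (subst bij_betw_cong[of _ _ \<phi>]) (use K(3) \<phi>(1) in \<open>auto simp: \<psi>_def\<close>)
  then have "bij_betw \<psi> (verts (add_vertex d X K)) (verts (add_vertex d X L))"
    using K(3) L(3) notIn_Un_bij_betw[of d "verts K" \<psi> "verts L"] d by simp
  moreover have "edges (add_vertex d X L) = (`) \<psi> ` edges (add_vertex d X K)"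
  proof -
    have "(`) \<psi> ` edges K = edges L" unfolding \<phi>(2)
      by (rule image_cong[OF refl], rule old) (use K(1) in \<open>simp add: simple_graph_def\<close>)
    moreover have "(`) \<psi> ` (\<lambda>x. {x, d}) ` X = (\<lambda>x. {x, d}) ` \<psi> ` X"
      by (simp add: image_image d)
    moreover have "\<psi> ` X = X" using old[OF K(2)] inv[OF \<phi>] by simp
    ultimately show ?thesis by (simp add: edges_add_vertex image_Un)
  qed
  ultimately show "add_vertex d X K \<simeq>\<^sub>g add_vertex d X L" unfolding graph_iso_def by blast
next
  let ?K = "add_vertex d X K" and ?L = "add_vertex d X L"
  have sK: "simple_graph ?K" using K by (rule simple_graph_add_vertex)
  have sL: "simple_graph ?L" using L by (rule simple_graph_add_vertex)
  assume "?K \<simeq>\<^sub>g ?L"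
  then obtain \<phi> where \<phi>: "bij_betw \<phi> (verts ?K) (verts ?L)" "edges ?L = (`) \<phi> ` edges ?K"
    unfolding graph_iso_def by blast
  have X: "\<phi> ` X = X" using inv'[of \<phi>] \<phi> by simp
  define w where "w = \<phi> d"
  have w: "w \<in> verts ?L" using \<phi>(1) unfolding w_def bij_betw_def by auto
  have "nbrs ?L w = nbrs ?L d"
    using nbrs_graph_iso[OF sK \<phi>, of d] X
    by (simp add: w_def nbrs_add_vertex_new[OF K(1,3)] nbrs_add_vertex_new[OF L(1,3)])
  then have tw: "(`) (transpose w d) ` edges ?L = edges ?L" by (rule transpose_twins_edges[OF sL])
  define \<psi> where "\<psi> = transpose w d \<circ> \<phi>"
  have "bij_betw (transpose w d) (verts ?L) (verts ?L)" using w by simp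
  then have b: "bij_betw \<psi> (verts ?K) (verts ?L)"
    unfolding \<psi>_def using \<phi>(1) bij_betw_trans by blast
  have d: "\<psi> d = d" by (simp add: \<psi>_def w_def)
  have E: "edges ?L = (`) \<psi> ` edges ?K"
    using tw unfolding \<phi>(2) \<psi>_def by (simp add: image_image image_comp)
  \<comment> \<open>The old edges are those avoiding \<open>d\<close>, a property preserved by
    \<open>\<psi>\<close> because it fixes \<open>d\<close>.\<close>
  have dK: "edges K = {s \<in> edges ?K. d \<notin> s}" and dL: "edges L = {s \<in> edges ?L. d \<notin> s}"
    using K L unfolding edges_add_vertex simple_graph_def by auto
  have m: "d \<in> \<psi> ` s \<longleftrightarrow> d \<in> s" if "s \<in> edges ?K" for s
  proof -
    have "s \<subseteq> verts ?K" using that sK by (auto simp: simple_graph_def)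
    then show ?thesis using inj_on_image_mem_iff[OF bij_betw_imp_inj_on[OF b], of d s] d by simp
  qed
  have "edges L = {s \<in> (`) \<psi> ` edges ?K. d \<notin> s}" using dL E by simp
  also have "\<dots> = (`) \<psi> ` {s \<in> edges ?K. d \<notin> s}" using m by blast
  also have "\<dots> = (`) \<psi> ` edges K" using dK by simp
  finally have "edges L = (`) \<psi> ` edges K" .
  moreover have "bij_betw \<psi> (verts K) (verts L)"
    using bij_betw_DiffI[OF b, of "{d}" "{d}"] d K(3) L(3) by (simp add: bij_betw_def)
  ultimately show "K \<simeq>\<^sub>g L" unfolding graph_iso_def by blast
qed

section \<open>Joins with an independent set\<close>

definition join_indep :: "'a graph \<Rightarrow> 'a set \<Rightarrow> 'a graph" where
  "join_indep H I = (verts H \<union> I, edges H \<union> (\<Union>u \<in> I. (\<lambda>x. {x, u}) ` verts H))"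

lemma verts_join [simp]: "verts (join_indep H I) = verts H \<union> I"
  and edges_join: "edges (join_indep H I) = edges H \<union> (\<Union>u \<in> I. (\<lambda>x. {x, u}) ` verts H)"
  by (simp_all add: join_indep_def)

locale indep_join =
  fixes H :: "'a::infinite graph" and I :: "'a set"
  assumes simple: "simple_graph H" and fin: "finite I" and disj: "verts H \<inter> I = {}"
begin

lemma simple_graph_join: "simple_graph (join_indep H I)"
proof -
  have "s \<subseteq> verts H \<union> I \<and> card s = 2" if s: "s \<in> edges (join_indep H I)" for s
  proof (cases "s \<in> edges H")
    case True
    then show ?thesis using simple by (auto simp: simple_graph_def)
  next
    case False
    then obtain u x where "u \<in> I" "x \<in> verts H" "s = {x, u}" using s unfolding edges_join by blast
    moreover from this have "x \<noteq> u" using disj by blast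
    ultimately show ?thesis by auto
  qed
  then show ?thesis using simple fin unfolding simple_graph_def by simp
qed

lemma nbrs_join_indep:
  assumes "u \<in> I" shows "nbrs (join_indep H I) u = verts H"
proof -
  have u: "u \<notin> verts H" using assms disj by blast
  then have "{x, u} \<notin> edges H" for x using simple_graph_edgeD(2)[OF simple] by blast
  then show ?thesis using assms u unfolding nbrs_def edges_join by (auto simp: doubleton_eq_iff)
qed

lemma nbrs_join_base:
  assumes "x \<in> verts H" shows "nbrs (join_indep H I) x = nbrs H x \<union> I"
proof -
  have x: "x \<notin> I" using assms disj by blast
  then show ?thesis using assms disj unfolding nbrs_def edges_join by (auto simp: doubleton_eq_iff)
qed

lemma join_edge_indep: "u \<in> I \<Longrightarrow> {x, u} \<in> edges (join_indep H I) \<longleftrightarrow> x \<in> verts H"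
  using nbrs_join_indep unfolding nbrs_def by blast

lemma join_edge_base:
  assumes "x \<in> verts H" "y \<in> verts H"
  shows "{x, y} \<in> edges (join_indep H I) \<longleftrightarrow> {x, y} \<in> edges H"
  using nbrs_join_base[OF assms(2)] assms(1) disj unfolding nbrs_def by blast

lemma packing_edge:
  assumes "packing (join_indep H I) P" "T \<in> P" "x \<in> T" "y \<in> T" "x \<noteq> y"
  shows "{x, y} \<in> edges (join_indep H I)"
  using packingD(3)[OF assms(1,2)] assms doubleton_in_pairs[of x y T] by blast

text \<open>Two vertices of \<open>I\<close> are never adjacent, so a triangle contains at most one
  of them.\<close>

lemma packing_one_indep:
  assumes "packing (join_indep H I) P" "T \<in> P" "x \<in> T" "u \<in> T" "u \<in> I" "x \<noteq> u"
  shows "x \<in> verts H"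
  using packing_edge[OF assms(1,2,3,4,6)] join_edge_indep[OF assms(5)] by blast

text \<open>Every packed triangle at \<open>x\<close> contains a second vertex of \<open>H\<close>,
  and distinct triangles give distinct neighbours of \<open>x\<close> in \<open>H\<close>. So at
  most as many neighbours are lost as \<open>x\<close> has in \<open>H\<close>, and the contribution
  of \<open>I\<close> to the degree is left.\<close>

lemma card_indep_le_nbrs_starred:
  assumes P: "packing (join_indep H I) P" and f: "labelling (join_indep H I) P f"
    and x: "x \<in> verts H"
  shows "card I \<le> card (nbrs (starred (join_indep H I) P f) x)"
proof -
  let ?Q = "{T \<in> P. x \<in> T}"
  have finH: "finite (nbrs H x)" using finite_nbrs[OF simple] .
  have "card ?Q \<le> card (nbrs H x)"
  proof (rule card_le_card_if_disjoint_choices[where A = "\<lambda>T. T - {x}"])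
    show "finite (nbrs H x)" by (rule finH)
    fix T assume T: "T \<in> ?Q"
    then obtain a b where ab: "a \<in> T" "b \<in> T" "a \<noteq> b" "a \<noteq> x" "b \<noteq> x"
      using packingD(1)[OF P, of T] by (auto simp: card_3_iff)
    have "a \<in> verts H \<or> b \<in> verts H"
    proof (rule ccontr)
      assume n: "\<not> ?thesis"
      then have "b \<in> I" using packingD(2)[OF P, of T] T ab by auto
      then show False using packing_one_indep[OF P, of T a b] T ab n by blast
    qed
    then obtain y where y: "y \<in> T" "y \<noteq> x" "y \<in> verts H" using ab by blast
    then have "{y, x} \<in> edges H" using packing_edge[OF P, of T y x] T join_edge_base x by blast
    then show "(T - {x}) \<inter> nbrs H x \<noteq> {}" using y by (auto simp: nbrs_def)
  next
    fix S T assume "S \<in> ?Q" "T \<in> ?Q" "S \<noteq> T"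
    then show "(S - {x}) \<inter> (T - {x}) \<inter> nbrs H x = {}"
      using packing_disjoint[OF P, of S T x] by blast
  qed
  moreover have "nbrs H x \<inter> I = {}" using nbrs_subset[OF simple, of x] disj by blast
  then have "card (nbrs (join_indep H I) x) = card (nbrs H x) + card I"
    unfolding nbrs_join_base[OF x] using fin finH by (simp add: card_Un_disjoint)
  ultimately show ?thesis using card_nbrs_starred(1)[OF simple_graph_join P f, of x] x by simp
qed

text \<open>A vertex of \<open>I\<close> starts with degree \<open>card (verts H)\<close> and loses
  at most half of it.\<close>

lemma nbrs_starred_indep_bounds:
  assumes P: "packing (join_indep H I) P" and f: "labelling (join_indep H I) P f" and u: "u \<in> I"
  shows "card (nbrs (starred (join_indep H I) P f) u) \<le> card (verts H)"
    and "card (verts H) \<le> 2 * card (nbrs (starred (join_indep H I) P f) u)"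
  using card_nbrs_starred[OF simple_graph_join P f, of u] u nbrs_join_indep[OF u] by auto

lemma nbrs_starred_label:
  assumes "packing (join_indep H I) P" "labelling (join_indep H I) P f" "T \<in> P"
  shows "nbrs (starred (join_indep H I) P f) (f T) = T"
  using starred_edge_new[OF simple_graph_join assms] unfolding nbrs_def by blast

text \<open>Vertices of \<open>H\<close> keep degree at least \<open>card I\<close>, hence at least
  4; vertices of \<open>I\<close> keep at least half of 7, hence also at least 4. This is where the
  hypothesis of more than six vertices enters.\<close>

lemma degree_ne_3:
  assumes "7 \<le> card (verts H)" "4 \<le> card I"
    and "packing (join_indep H I) P" "labelling (join_indep H I) P f" "v \<in> verts H \<union> I"
  shows "card (nbrs (starred (join_indep H I) P f) v) \<noteq> 3"
  using assms card_indep_le_nbrs_starred[of P f v] nbrs_starred_indep_bounds(2)[of P f v] by force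

text \<open>Degrees separate the three kinds of vertices: at least \<open>card I\<close> in
  \<open>H\<close>, at most \<open>card (verts H)\<close> in \<open>I\<close>, and exactly 3 at
  labels. So \<open>H\<close> can be recovered from the isomorphism type.\<close>

lemma base_verts_by_degree:
  assumes "7 \<le> card (verts H)" "card (verts H) < card I"
    and P: "packing (join_indep H I) P" and f: "labelling (join_indep H I) P f"
  shows "verts H = {v \<in> verts (starred (join_indep H I) P f).
    card (verts H) < card (nbrs (starred (join_indep H I) P f) v)}" (is "_ = ?R")
proof
  show "verts H \<subseteq> ?R" using card_indep_le_nbrs_starred[OF P f] assms(2) by fastforce
  show "?R \<subseteq> verts H"
  proof
    fix v assume v: "v \<in> ?R"
    have "v \<notin> I" using nbrs_starred_indep_bounds(1)[OF P f, of v] v by auto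
    moreover have "v \<notin> f ` P" using nbrs_starred_label[OF P f] packingD(1)[OF P] v assms(1) by auto
    ultimately show "v \<in> verts H" using v by auto
  qed
qed

text \<open>A touched vertex of \<open>I\<close> claims the edge of \<open>H\<close> opposite to it
  in a packed triangle. No edge is claimed twice: distinct triangles are edge-disjoint, and a single
  triangle has only one vertex in \<open>I\<close>.\<close>

lemma untouched_indep:
  assumes P: "packing (join_indep H I) P" and "card (edges H) < card I"
  obtains u where "u \<in> I" "\<And>T. T \<in> P \<Longrightarrow> u \<notin> T"
proof -
  let ?J = "{u \<in> I. \<exists>T \<in> P. u \<in> T}"
  have "card ?J \<le> card (edges H)"
  proof (rule card_le_card_if_disjoint_choices[where A = "\<lambda>u. \<Union>T \<in> {T \<in> P. u \<in> T}. pairs T"])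
    show "finite (edges H)" by (rule finite_edges[OF simple])
    fix u assume "u \<in> ?J"
    then obtain T where T: "u \<in> I" "T \<in> P" "u \<in> T" by blast
    then obtain a b where ab: "a \<in> T" "b \<in> T" "a \<noteq> b" "a \<noteq> u" "b \<noteq> u"
      using packingD(1)[OF P, of T] by (auto simp: card_3_iff)
    then have "a \<in> verts H" "b \<in> verts H" using packing_one_indep[OF P] T by blast+
    then have "{a, b} \<in> edges H" using packing_edge[OF P T(2)] ab join_edge_base by blast
    moreover have "{a, b} \<in> pairs T" using ab by simp
    ultimately show "(\<Union>T \<in> {T \<in> P. u \<in> T}. pairs T) \<inter> edges H \<noteq> {}" using T by blast
  next
    fix u w assume uw: "u \<in> ?J" "w \<in> ?J" "u \<noteq> w"
    have "pairs S \<inter> pairs T = {}" if "S \<in> P" "T \<in> P" "u \<in> S" "w \<in> T" for S T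
    proof (cases "S = T")
      case True
      then have "u \<in> verts H" using packing_one_indep[OF P, of S u w] uw that by blast
      then show ?thesis using uw disj by blast
    next
      case False
      then show ?thesis using P that unfolding packing_def by blast
    qed
    then show "(\<Union>T \<in> {T \<in> P. u \<in> T}. pairs T) \<inter> (\<Union>T \<in> {T \<in> P. w \<in> T}. pairs T) \<inter> edges H = {}"
      by blast
  qed
  then have "?J \<noteq> I" using assms(2) by auto
  then show ?thesis using that by blast
qed

lemma packing_base_edge:
  assumes P: "packing (join_indep H I) P" and T: "T \<in> P"
  obtains a b where "a \<in> T" "b \<in> T" "a \<noteq> b" "a \<in> verts H" "b \<in> verts H" "{a, b} \<in> edges H"
proof -
  obtain p q r where pqr: "T = {p, q, r}" "p \<noteq> q" "q \<noteq> r" "p \<noteq> r"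
    using packingD(1)[OF P T] by (auto simp: card_3_iff)
  have "\<exists>a \<in> T. \<exists>b \<in> T. a \<noteq> b \<and> a \<in> verts H \<and> b \<in> verts H"
  proof (cases "T \<subseteq> verts H")
    case True
    then show ?thesis using pqr by blast
  next
    case False
    then obtain u where u: "u \<in> T" "u \<in> I" using packingD(2)[OF P T] by auto
    then have "\<forall>x \<in> T - {u}. x \<in> verts H" using packing_one_indep[OF P T] by blast
    then show ?thesis using pqr u by auto
  qed
  then show ?thesis using that packing_edge[OF P T] join_edge_base by blast
qed

section \<open>Families of joins\<close>

lemma family_join:
  assumes "7 \<le> card (verts H)" "4 \<le> card I"
  shows "family (join_indep H I) = {iso_class (starred (join_indep H I) P f) | P f.
    packing (join_indep H I) P \<and> labelling (join_indep H I) P f}"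
proof -
  have "cousin (join_indep H I) K \<longleftrightarrow> (\<exists>P f. packing (join_indep H I) P \<and>
      labelling (join_indep H I) P f \<and> K = starred (join_indep H I) P f)" for K
    using degree_ne_3[OF assms] by (intro cousin_iff_starred simple_graph_join) auto
  then have eq: "{K. cousin (join_indep H I) K} = {starred (join_indep H I) P f | P f.
      packing (join_indep H I) P \<and> labelling (join_indep H I) P f}"
    by (intro Collect_cong) auto
  show ?thesis unfolding family_def eq by blast
qed

lemma card_family_join_edgeless:
  assumes "edges H = {}" "7 \<le> card (verts H)" "4 \<le> card I \<or> I = {}"
  shows "card (family (join_indep H I)) = 1"
proof -
  let ?G = "join_indep H I"
  have empty: "P = {}" if "packing ?G P" for P
    using packing_base_edge[OF that] assms(1) by blast
  have "card (nbrs (starred ?G P f) v) \<noteq> 3"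
    if P: "packing ?G P" "labelling ?G P f" "v \<in> verts ?G" for P f v
  proof (cases "I = {}")
    \<comment> \<open>This is the join with an empty last part, where the bound on
      \<open>card I\<close> fails; but then there are no edges, and every degree is 0.\<close>
    case True
    then have "nbrs (starred ?G P f) v = {}"
      using empty[OF P(1)] assms(1) by (simp add: nbrs_def edges_join)
    then show ?thesis by simp
  next
    case False
    then show ?thesis using degree_ne_3[OF assms(2) _ P(1,2)] P(3) assms(3) by auto
  qed
  then have "cousin ?G K \<longleftrightarrow> (\<exists>P f. packing ?G P \<and> labelling ?G P f \<and> K = starred ?G P f)" for K
    by (intro cousin_iff_starred simple_graph_join)
  then have "cousin ?G K \<Longrightarrow> K = ?G" for K using empty by fastforce
  moreover have "cousin ?G ?G" by (simp add: cousin_def)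
  ultimately have "{K. cousin ?G K} = {?G}" by blast
  then show ?thesis by (simp add: family_def)
qed

end

section \<open>Enlarging the independent set by one vertex\<close>

lemma image_edges_if_fixed:
  assumes "simple_graph G" "\<And>x. x \<in> verts G \<Longrightarrow> \<psi> x = x"
  shows "(`) \<psi> ` edges G = edges G"
proof -
  have "\<psi> ` s = s" if "s \<in> edges G" for s
    using that assms unfolding simple_graph_def by force
  then show ?thesis by simp
qed

lemma join_permute_edges:
  assumes "\<psi> ` verts H = verts H" "(`) \<psi> ` edges H = edges H" "\<psi> ` I = I"
  shows "(`) \<psi> ` edges (join_indep H I) = edges (join_indep H I)"
proof -
  have "(`) \<psi> ` (\<Union>u \<in> I. (\<lambda>x. {x, u}) ` verts H) = (\<Union>u \<in> \<psi> ` I. (\<lambda>x. {x, u}) ` \<psi> ` verts H)"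
    by (simp add: image_UN image_image)
  then show ?thesis using assms by (simp add: edges_join image_Un)
qed

lemma indep_join_insert:
  assumes "indep_join H I" "d \<notin> verts H \<union> I" shows "indep_join H (insert d I)"
  using assms by (auto simp: indep_join_def)

lemma packing_join_mono:
  assumes "packing (join_indep H I) P" "I \<subseteq> J" shows "packing (join_indep H J) P"
proof -
  have "edges (join_indep H I) \<subseteq> edges (join_indep H J)" using assms(2) unfolding edges_join by blast
  moreover have "verts (join_indep H I) \<subseteq> verts (join_indep H J)" using assms(2) by auto
  ultimately show ?thesis using assms(1) unfolding packing_def by (meson subset_trans)
qed

lemma packing_join_restrict:
  assumes P: "packing (join_indep H (insert d I)) P" and d: "\<And>T. T \<in> P \<Longrightarrow> d \<notin> T"
  shows "packing (join_indep H I) P"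
proof -
  have "T \<subseteq> verts H \<union> I" if "T \<in> P" for T
    using packingD(2)[OF P that] d[OF that] by auto
  moreover have "pairs T \<subseteq> edges (join_indep H I)" if "T \<in> P" for T
  proof -
    have "d \<notin> s" if "s \<in> pairs T" for s using that d[OF \<open>T \<in> P\<close>] by (auto simp: pairs_def)
    then show ?thesis using packingD(3)[OF P that] unfolding edges_join by blast
  qed
  ultimately show ?thesis using P unfolding packing_def by simp
qed

lemma labelling_join_anti:
  "labelling (join_indep H J) P f \<Longrightarrow> I \<subseteq> J \<Longrightarrow> labelling (join_indep H I) P f"
  unfolding labelling_def by auto

text \<open>No triangle of a packing of the smaller join contains \<open>d\<close>, so all edges at
  \<open>d\<close> survive the moves.\<close>

lemma starred_join_insert:
  assumes P: "packing (join_indep H I) P" and d: "d \<notin> verts H \<union> I"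
  shows "starred (join_indep H (insert d I)) P f =
    add_vertex d (verts H) (starred (join_indep H I) P f)"
proof -
  have "d \<notin> T" if "T \<in> P" for T using packingD(2)[OF P that] d by auto
  then have "(\<lambda>x. {x, d}) ` verts H \<inter> \<Union>(pairs ` P) = {}" by auto
  then have "edges (starred (join_indep H (insert d I)) P f) =
    edges (add_vertex d (verts H) (starred (join_indep H I) P f))"
    unfolding edges_starred edges_add_vertex edges_join UN_insert by blast
  then show ?thesis by (simp add: prod_eq_iff)
qed

text \<open>Labels avoid \<open>d\<close>, so that a state makes sense both before and after \<open>d\<close> is added to \<open>I\<close>.\<close>

definition states :: "'a graph \<Rightarrow> 'a set \<Rightarrow> 'a \<Rightarrow> ('a set set \<times> ('a set \<Rightarrow> 'a)) set" where
  "states H I d = {(P, f). packing (join_indep H I) P \<and> labelling (join_indep H (insert d I)) P f}"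

text \<open>Forbidding the label \<open>d\<close> loses no isomorphism class, because labels can be
  renamed.\<close>

lemma family_join_states:
  assumes j: "indep_join H I" and d: "d \<notin> verts H \<union> I"
    and c: "7 \<le> card (verts H)" "4 \<le> card I"
  shows "family (join_indep H I) = (\<lambda>(P, f). iso_class (starred (join_indep H I) P f)) ` states H I d"
proof -
  interpret indep_join H I by (rule j)
  let ?G = "join_indep H I"
  have "iso_class (starred ?G P f) \<in> (\<lambda>(P, f). iso_class (starred ?G P f)) ` states H I d"
    if P: "packing ?G P" and f: "labelling ?G P f" for P f
  proof -
    have "finite (insert d (verts ?G) \<union> f ` P)"
      using simple_graph_join finite_packing[OF simple_graph_join P] by (simp add: simple_graph_def)
    then obtain z where z: "z \<notin> insert d (verts ?G) \<union> f ` P"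
      using ex_new_if_finite[OF infinite_UNIV] by blast
    \<comment> \<open>Neither \<open>d\<close> nor \<open>z\<close> is a vertex of
      \<open>?G\<close>, so this swap fixes \<open>?G\<close> and the packing and only frees
      \<open>d\<close> from use as a label.\<close>
    let ?\<psi> = "transpose d z" let ?g = "?\<psi> \<circ> f"
    have fixed: "?\<psi> x = x" if "x \<in> verts ?G" for x using that z d by (auto simp: transpose_def)
    have T: "?\<psi> ` T = T" if "T \<in> P" for T
      using packingD(2)[OF P that] fixed by force
    have 1: "?\<psi> ` verts ?G = verts ?G" using fixed by force
    have 2: "(`) ?\<psi> ` edges ?G = edges ?G" by (rule image_edges_if_fixed[OF simple_graph_join fixed])
    have 3: "P = (`) ?\<psi> ` P" using T by simp
    have 4: "?g (?\<psi> ` S) = ?\<psi> (f S)" if "S \<in> P" for S using T[OF that] by simp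
    note iso = starred_permute_iso[OF bij_transpose 1 2 3, of ?g f, OF 4]
    have g: "labelling ?G P ?g" using iso(3) f by blast
    moreover have "d \<notin> ?g ` P" using z by (auto simp: transpose_def split: if_splits)
    ultimately have "(P, ?g) \<in> states H I d" using P by (auto simp: states_def labelling_def)
    moreover have "iso_class (starred ?G P f) = iso_class (starred ?G P ?g)"
      by (rule iso_class_eqI[OF iso(1) simple_graph_starred[OF simple_graph_join P f]])
    ultimately show ?thesis by blast
  qed
  then have sub: "family ?G \<subseteq> (\<lambda>(P, f). iso_class (starred ?G P f)) ` states H I d"
    unfolding family_join[OF c] by blast
  have "iso_class (starred ?G P f) \<in> family ?G" if "(P, f) \<in> states H I d" for P f
  proof -
    have "packing ?G P" "labelling ?G P f"
      using that labelling_join_anti[of H "insert d I" P f I] by (auto simp: states_def)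
    then show ?thesis unfolding family_join[OF c] by blast
  qed
  then show ?thesis using sub by auto
qed

text \<open>The set \<open>insert d I\<close> has more vertices than \<open>H\<close> has edges, so
  every packing leaves one of them untouched. Exchanging it with \<open>d\<close> makes the packing
  avoid \<open>d\<close>, so it is already a packing of the smaller join.\<close>

lemma family_join_insert_states:
  assumes j: "indep_join H I" and d: "d \<notin> verts H \<union> I"
    and c: "7 \<le> card (verts H)" "4 \<le> card I" and e: "card (edges H) \<le> card I"
  shows "family (join_indep H (insert d I)) =
    (\<lambda>(P, f). iso_class (starred (join_indep H (insert d I)) P f)) ` states H I d"
proof -
  let ?J = "insert d I"
  interpret indep_join H ?J by (rule indep_join_insert[OF j d])
  have cJ: "card ?J = Suc (card I)" using d fin by simp
  let ?G = "join_indep H ?J"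
  have "iso_class (starred ?G P f) \<in> (\<lambda>(P, f). iso_class (starred ?G P f)) ` states H I d"
    if P: "packing ?G P" and f: "labelling ?G P f" for P f
  proof -
    obtain u where u: "u \<in> ?J" "\<And>T. T \<in> P \<Longrightarrow> u \<notin> T"
      using untouched_indep[OF P] e cJ by (metis less_Suc_eq_le)
    let ?\<psi> = "transpose u d"
    \<comment> \<open>The transposition is its own inverse: the inner application returns to the
      original triangle, whose label is then transported.\<close>
    define g where "g T = ?\<psi> (f (?\<psi> ` T))" for T
    have J: "?\<psi> ` ?J = ?J" using u(1) by (intro transpose_image_eq) simp
    have fixed: "?\<psi> x = x" if "x \<in> verts H" for x using that u(1) disj by (auto simp: transpose_def)
    then have X: "?\<psi> ` verts H = verts H" by force
    have 1: "?\<psi> ` verts ?G = verts ?G" unfolding verts_join image_Un X J ..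
    have 2: "(`) ?\<psi> ` edges ?G = edges ?G"
      by (rule join_permute_edges[OF X image_edges_if_fixed[OF simple fixed] J])
    have 4: "g (?\<psi> ` S) = ?\<psi> (f S)" for S by (simp add: g_def image_image)
    let ?Q = "(`) ?\<psi> ` P"
    note iso = starred_permute_iso[OF bij_transpose 1 2 refl, of P g f, OF 4]
    have Q: "packing ?G ?Q" "labelling ?G ?Q g" using iso(2,3) P f by blast+
    have "d \<notin> T" if T: "T \<in> ?Q" for T
    proof
      assume "d \<in> T"
      then obtain S x where "S \<in> P" "x \<in> S" "d = ?\<psi> x" using T by blast
      moreover from this have "x = u" by (auto simp: transpose_def split: if_splits)
      ultimately show False using u(2) by blast
    qed
    then have "packing (join_indep H I) ?Q" by (rule packing_join_restrict[OF Q(1)])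
    then have "(?Q, g) \<in> states H I d" using Q(2) by (simp add: states_def)
    moreover have "iso_class (starred ?G P f) = iso_class (starred ?G ?Q g)"
      by (rule iso_class_eqI[OF iso(1) simple_graph_starred[OF simple_graph_join P f]])
    ultimately show ?thesis by blast
  qed
  moreover have c4: "4 \<le> card ?J" using cJ c(2) by simp
  ultimately have sub: "family ?G \<subseteq> (\<lambda>(P, f). iso_class (starred ?G P f)) ` states H I d"
    unfolding family_join[OF c(1) c4] by blast
  have "iso_class (starred ?G P f) \<in> family ?G" if "(P, f) \<in> states H I d" for P f
  proof -
    have "packing ?G P" "labelling ?G P f"
      using that packing_join_mono[of H I P ?J] by (auto simp: states_def)
    then show ?thesis unfolding family_join[OF c(1) c4] by blast
  qed
  then show ?thesis using sub by auto
qed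

section \<open>Comparison of the two families\<close>

text \<open>Both families are images of the same set of states, so it suffices that the two
  isomorphism relations on states agree.\<close>

lemma card_family_join_insert:
  assumes j: "indep_join H I" and d: "d \<notin> verts H \<union> I"
    and c: "7 \<le> card (verts H)" "4 \<le> card I" and e: "card (edges H) \<le> card I"
    and iso: "\<And>P f Q g. (P, f) \<in> states H I d \<Longrightarrow> (Q, g) \<in> states H I d \<Longrightarrow>
      starred (join_indep H I) P f \<simeq>\<^sub>g starred (join_indep H I) Q g \<longleftrightarrow>
      starred (join_indep H (insert d I)) P f \<simeq>\<^sub>g starred (join_indep H (insert d I)) Q g"
  shows "card (family (join_indep H (insert d I))) = card (family (join_indep H I))"
proof -
  let ?G = "join_indep H I" and ?G' = "join_indep H (insert d I)"
  interpret I: indep_join H I by (rule j)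
  interpret J: indep_join H "insert d I" by (rule indep_join_insert[OF j d])
  have s: "simple_graph (starred ?G P f)" "simple_graph (starred ?G' P f)"
    if "(P, f) \<in> states H I d" for P f
    using that simple_graph_starred[OF I.simple_graph_join] simple_graph_starred[OF J.simple_graph_join]
      packing_join_mono[of H I P "insert d I"] labelling_join_anti[of H "insert d I" P f I]
    by (auto simp: states_def)
  have kernel: "(iso_class (starred ?G' P f) = iso_class (starred ?G' Q g)) =
      (iso_class (starred ?G P f) = iso_class (starred ?G Q g))"
    if "(P, f) \<in> states H I d" "(Q, g) \<in> states H I d" for P f Q g
    using iso_class_eq_iff s that iso[OF that] by metis
  have "card ((\<lambda>(P, f). iso_class (starred ?G' P f)) ` states H I d) =
      card ((\<lambda>(P, f). iso_class (starred ?G P f)) ` states H I d)"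
  proof (rule card_image_eq_if_same_kernel)
    fix s t assume "s \<in> states H I d" "t \<in> states H I d"
    then show "((case s of (P, f) \<Rightarrow> iso_class (starred ?G' P f)) = (case t of (P, f) \<Rightarrow> iso_class (starred ?G' P f))) =
      ((case s of (P, f) \<Rightarrow> iso_class (starred ?G P f)) = (case t of (P, f) \<Rightarrow> iso_class (starred ?G P f)))"
      using kernel[of "fst s" "snd s" "fst t" "snd t"] by (simp add: case_prod_beta)
  qed
  then show ?thesis
    unfolding family_join_states[OF j d c] family_join_insert_states[OF j d c e] .
qed

text \<open>With more vertices in \<open>I\<close> than in \<open>H\<close>, isomorphisms preserve
  \<open>verts H\<close> both with and without \<open>d\<close>, which is what
  \<open>add_vertex_iso_iff\<close> requires.\<close>

lemma card_family_join_insert_dense: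
  assumes j: "indep_join H I" and d: "d \<notin> verts H \<union> I"
    and c: "7 \<le> card (verts H)" "card (verts H) < card I" "card (edges H) \<le> card I"
  shows "card (family (join_indep H (insert d I))) = card (family (join_indep H I))"
proof (rule card_family_join_insert[OF j d c(1) _ c(3)])
  show "4 \<le> card I" using c by simp
  let ?G = "join_indep H I" and ?G' = "join_indep H (insert d I)"
  interpret I: indep_join H I by (rule j)
  interpret J: indep_join H "insert d I" by (rule indep_join_insert[OF j d])
  have cJ: "card (verts H) < card (insert d I)" using c(2) d I.fin by simp
  fix P f Q g assume st: "(P, f) \<in> states H I d" "(Q, g) \<in> states H I d"
  have P: "packing ?G P" "labelling ?G P f" "packing ?G' P" "labelling ?G' P f"
    and Q: "packing ?G Q" "labelling ?G Q g" "packing ?G' Q" "labelling ?G' Q g"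
    using st packing_join_mono[of H I _ "insert d I"] labelling_join_anti[of H "insert d I" _ _ I]
    by (auto simp: states_def)
  note ext = starred_join_insert[OF P(1) d, of f] starred_join_insert[OF Q(1) d, of g]
  show "starred ?G P f \<simeq>\<^sub>g starred ?G Q g \<longleftrightarrow> starred ?G' P f \<simeq>\<^sub>g starred ?G' Q g"
    unfolding ext
  proof (rule add_vertex_iso_iff)
    show "simple_graph (starred ?G P f)" "simple_graph (starred ?G Q g)"
      using simple_graph_starred[OF I.simple_graph_join] P Q by blast+
    show "verts H \<subseteq> verts (starred ?G P f)" "verts H \<subseteq> verts (starred ?G Q g)" by auto
    show "d \<notin> verts (starred ?G P f)" "d \<notin> verts (starred ?G Q g)"
      using d P(4) Q(4) by (auto simp: labelling_def)
  next
    fix \<phi> assume \<phi>: "bij_betw \<phi> (verts (starred ?G P f)) (verts (starred ?G Q g))"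
      "edges (starred ?G Q g) = (`) \<phi> ` edges (starred ?G P f)"
    show "\<phi> ` verts H = verts H"
      using graph_iso_image_degree_gt[OF simple_graph_starred[OF I.simple_graph_join P(1,2)] \<phi>,
          of "card (verts H)"]
      by (simp only: I.base_verts_by_degree[OF c(1,2) P(1,2), symmetric]
          I.base_verts_by_degree[OF c(1,2) Q(1,2), symmetric])
  next
    fix \<phi> assume "bij_betw \<phi> (insert d (verts (starred ?G P f))) (insert d (verts (starred ?G Q g)))"
      "edges (add_vertex d (verts H) (starred ?G Q g)) =
        (`) \<phi> ` edges (add_vertex d (verts H) (starred ?G P f))"
    then have \<phi>: "bij_betw \<phi> (verts (starred ?G' P f)) (verts (starred ?G' Q g))"
      "edges (starred ?G' Q g) = (`) \<phi> ` edges (starred ?G' P f)"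
      unfolding ext by simp_all
    show "\<phi> ` verts H = verts H"
      using graph_iso_image_degree_gt[OF simple_graph_starred[OF J.simple_graph_join P(3,4)] \<phi>,
          of "card (verts H)"]
      by (simp only: J.base_verts_by_degree[OF c(1) cJ P(3,4), symmetric]
          J.base_verts_by_degree[OF c(1) cJ Q(3,4), symmetric])
  qed
qed

section \<open>Joins of a star\<close>

text \<open>The images of \<open>x\<close> and \<open>y\<close> have equally many elements, hence so
  do their complements in the finite set \<open>S\<close>. Any bijection of the complements
  completes the partial map, and the identity is used outside \<open>S\<close>.\<close>

lemma ex_bij_extending:
  assumes S: "finite S" and x: "inj_on x P" "x ` P \<subseteq> S" and y: "inj_on y P" "y ` P \<subseteq> S"
  obtains \<psi> where "bij \<psi>" "\<psi> ` S = S" "\<And>v. v \<notin> S \<Longrightarrow> \<psi> v = v" "\<And>i. i \<in> P \<Longrightarrow> \<psi> (x i) = y i"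
proof -
  have "card (x ` P) = card (y ` P)" using x(1) y(1) by (simp add: card_image)
  then have "card (S - x ` P) = card (S - y ` P)"
    using S x(2) y(2) by (simp add: card_Diff_subset finite_subset)
  then obtain k where k: "bij_betw k (S - x ` P) (S - y ` P)"
    using S finite_same_card_bij by blast
  define \<psi> where
    "\<psi> v = (if v \<in> x ` P then y (inv_into P x v) else if v \<in> S then k v else v)" for v
  have xy: "\<psi> (x i) = y i" if "i \<in> P" for i using that x(1) by (simp add: \<psi>_def)
  have "bij_betw \<psi> (x ` P) (y ` P)"
  proof (rule bij_betw_imageI)
    show "inj_on \<psi> (x ` P)" using xy y(1) by (auto simp: inj_on_def)
    show "\<psi> ` x ` P = y ` P" using xy by (simp add: image_image)
  qed
  moreover have "bij_betw \<psi> (S - x ` P) (S - y ` P)"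
    by (subst bij_betw_cong[of _ _ k]) (use k in \<open>auto simp: \<psi>_def\<close>)
  ultimately have "bij_betw \<psi> (x ` P \<union> (S - x ` P)) (y ` P \<union> (S - y ` P))"
    by (rule bij_betw_combine) blast
  moreover have "x ` P \<union> (S - x ` P) = S" "y ` P \<union> (S - y ` P) = S" using x(2) y(2) by auto
  ultimately have bS: "bij_betw \<psi> S S" by simp
  have out: "\<psi> v = v" if "v \<notin> S" for v using that x(2) by (auto simp: \<psi>_def)
  then have "bij_betw \<psi> (- S) (- S)"
    by (subst bij_betw_cong[of _ _ id]) auto
  with bS have "bij_betw \<psi> (S \<union> - S) (S \<union> - S)" by (rule bij_betw_combine) simp
  then have "bij \<psi>" by (simp add: Compl_partition)
  then show ?thesis using that bS out xy by (auto simp: bij_betw_def)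
qed

locale star_join = indep_join H I for H :: "'a::infinite graph" and I +
  fixes z :: 'a and L :: "'a set"
  assumes verts_star: "verts H = insert z L" and center: "z \<notin> L"
    and edges_star: "edges H = (\<lambda>x. {z, x}) ` L"
begin

text \<open>A packed triangle contains an edge of the star, hence the centre and a leaf. Leaves are
  pairwise non-adjacent, so its third vertex is in \<open>I\<close>.\<close>

lemma packing_star:
  assumes P: "packing (join_indep H I) P" and T: "T \<in> P"
  shows "\<exists>x u. x \<in> L \<and> u \<in> I \<and> T = {z, x, u}"
proof -
  obtain a b where ab: "a \<in> T" "b \<in> T" "a \<noteq> b" "{a, b} \<in> edges H"
    using packing_base_edge[OF P T] by metis
  then obtain x where x: "x \<in> L" "{a, b} = {z, x}" unfolding edges_star by blast
  then have zx: "z \<in> T" "x \<in> T" "z \<noteq> x" using ab center by (auto simp: doubleton_eq_iff)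
  then obtain u where u: "T = {z, x, u}" "u \<noteq> z" "u \<noteq> x"
    using packingD(1)[OF P T] by (auto simp: card_3_iff)
  have "u \<notin> L"
  proof
    assume "u \<in> L"
    then have "{x, u} \<in> edges H"
      using join_edge_base[of x u] packing_edge[OF P T, of x u] u x verts_star by auto
    then show False using x u(2) zx(3) unfolding edges_star by (auto simp: doubleton_eq_iff)
  qed
  then have "u \<in> I" using packingD(2)[OF P T] u verts_star by auto
  then show ?thesis using x u by blast
qed

text \<open>All packed triangles contain \<open>z\<close>; two that also agreed in the leaf or in
  the vertex of \<open>I\<close> would share an edge.\<close>

lemma packing_star_coordinates:
  assumes P: "packing (join_indep H I) P"
  obtains x u where "x ` P \<subseteq> L" "u ` P \<subseteq> I" "inj_on x P" "inj_on u P"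
    "\<And>T. T \<in> P \<Longrightarrow> T = {z, x T, u T}"
proof -
  obtain x u where xu: "\<And>T. T \<in> P \<Longrightarrow> x T \<in> L \<and> u T \<in> I \<and> T = {z, x T, u T}"
    using packing_star[OF P] by metis
  have zn: "z \<notin> I" using disj verts_star by blast
  have "inj_on x P"
  proof (rule inj_onI)
    fix S T assume ST: "S \<in> P" "T \<in> P" "x S = x T"
    then show "S = T" using packing_disjoint[OF P, of S T z "x S"] xu[of S] xu[of T] center by blast
  qed
  moreover have "inj_on u P"
  proof (rule inj_onI)
    fix S T assume ST: "S \<in> P" "T \<in> P" "u S = u T"
    then show "S = T" using packing_disjoint[OF P, of S T z "u S"] xu[of S] xu[of T] zn by blast
  qed
  ultimately show ?thesis using that xu by blast
qed

text \<open>In \<open>K\<^bsub>1,k,N\<^esub>\<close> a triangle packing is a matching between the two large parts, so only its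
  size matters up to symmetry.\<close>

lemma starred_star_iso_iff:
  assumes P: "packing (join_indep H I) P" and f: "labelling (join_indep H I) P f"
    and Q: "packing (join_indep H I) Q" and g: "labelling (join_indep H I) Q g"
  shows "starred (join_indep H I) P f \<simeq>\<^sub>g starred (join_indep H I) Q g \<longleftrightarrow> card P = card Q"
proof
  let ?G = "join_indep H I"
  \<comment> \<open>Each move adds one vertex, so the vertex count determines the size of the
    packing.\<close>
  have cV: "card (verts (starred ?G R h)) = card (verts ?G) + card R"
    if R: "packing ?G R" "labelling ?G R h" for R h
  proof -
    have "card (verts ?G \<union> h ` R) = card (verts ?G) + card (h ` R)"
      using R simple_graph_join finite_packing[OF simple_graph_join R(1)]
      by (intro card_Un_disjoint) (auto simp: labelling_def simple_graph_def)
    then show ?thesis using R(2) by (simp add: labelling_def card_image)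
  qed
  assume "starred ?G P f \<simeq>\<^sub>g starred ?G Q g"
  then obtain \<phi> where "bij_betw \<phi> (verts (starred ?G P f)) (verts (starred ?G Q g))"
    unfolding graph_iso_def by blast
  then have "card (verts (starred ?G P f)) = card (verts (starred ?G Q g))"
    by (rule bij_betw_same_card)
  then show "card P = card Q" using cV[OF P f] cV[OF Q g] by simp
next
  let ?G = "join_indep H I"
  assume "card P = card Q"
  moreover have finP: "finite P" and finQ: "finite Q"
    using finite_packing[OF simple_graph_join] P Q by auto
  ultimately obtain h where h: "bij_betw h P Q" using finite_same_card_bij by blast
  then have hQ: "h ` P = Q" and hi: "inj_on h P" by (auto simp: bij_betw_def)
  obtain x u where xu: "x ` P \<subseteq> L" "u ` P \<subseteq> I" "inj_on x P" "inj_on u P"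
      "\<And>T. T \<in> P \<Longrightarrow> T = {z, x T, u T}"
    by (rule packing_star_coordinates[OF P]) (rule that)
  obtain y w where yw: "y ` Q \<subseteq> L" "w ` Q \<subseteq> I" "inj_on y Q" "inj_on w Q"
      "\<And>T. T \<in> Q \<Longrightarrow> T = {z, y T, w T}"
    by (rule packing_star_coordinates[OF Q]) (rule that)
  have finL: "finite L" using simple verts_star by (simp add: simple_graph_def)
  have comp: "inj_on (\<lambda>T. k (h T)) P" if "inj_on k Q" for k :: "'a set \<Rightarrow> 'a"
    using comp_inj_on[OF hi, of k] that hQ by (simp add: comp_def)
  have yL: "(\<lambda>T. y (h T)) ` P \<subseteq> L" using yw(1) hQ by auto
  obtain \<alpha> where \<alpha>: "bij \<alpha>" "\<alpha> ` L = L" "\<And>v. v \<notin> L \<Longrightarrow> \<alpha> v = v" "\<And>T. T \<in> P \<Longrightarrow> \<alpha> (x T) = y (h T)"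
    by (rule ex_bij_extending[OF finL xu(3,1) comp[OF yw(3)] yL]) (rule that)
  have wI: "(\<lambda>T. w (h T)) ` P \<subseteq> I" using yw(2) hQ by auto
  obtain \<beta> where \<beta>: "bij \<beta>" "\<beta> ` I = I" "\<And>v. v \<notin> I \<Longrightarrow> \<beta> v = v" "\<And>T. T \<in> P \<Longrightarrow> \<beta> (u T) = w (h T)"
    by (rule ex_bij_extending[OF fin xu(4,2) comp[OF yw(4)] wI]) (rule that)
  let ?F = "f ` P \<union> g ` Q"
  have fi: "inj_on f P" "f ` P \<subseteq> ?F" and gi: "inj_on g Q" using f g by (auto simp: labelling_def)
  have finF: "finite ?F" and gF: "(\<lambda>T. g (h T)) ` P \<subseteq> ?F" using finP finQ hQ by auto
  obtain \<gamma> where \<gamma>: "bij \<gamma>" "\<gamma> ` ?F = ?F" "\<And>v. v \<notin> ?F \<Longrightarrow> \<gamma> v = v" "\<And>T. T \<in> P \<Longrightarrow> \<gamma> (f T) = g (h T)"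
    by (rule ex_bij_extending[OF finF fi comp[OF gi] gF]) (rule that)
  have F: "?F \<inter> (insert z L \<union> I) = {}" using f g verts_star by (auto simp: labelling_def)
  have LI: "insert z L \<inter> I = {}" using disj verts_star by simp
  \<comment> \<open>The three permutations move only points of the pairwise disjoint sets
    \<open>L\<close>, \<open>I\<close> and \<open>?F\<close>, so each acts unchanged on its own set,
    and \<open>z\<close> stays fixed.\<close>
  define \<psi> where "\<psi> = \<alpha> \<circ> \<beta> \<circ> \<gamma>"
  have b: "bij \<psi>" unfolding \<psi>_def using \<alpha>(1) \<beta>(1) \<gamma>(1) bij_comp by blast
  have z: "\<psi> z = z"
  proof -
    have "\<gamma> z = z" "\<beta> z = z" using \<beta>(3) \<gamma>(3) F LI by blast+
    then show ?thesis using \<alpha>(3)[OF center] by (simp add: \<psi>_def)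
  qed
  have onL: "\<psi> v = \<alpha> v" if "v \<in> L" for v
  proof -
    have "\<gamma> v = v" "\<beta> v = v" using \<beta>(3) \<gamma>(3) F LI that by blast+
    then show ?thesis by (simp add: \<psi>_def)
  qed
  have onI: "\<psi> v = \<beta> v" if "v \<in> I" for v
  proof -
    have "\<gamma> v = v" using \<gamma>(3) F that by blast
    moreover have "\<beta> v \<in> I" using \<beta>(2) that by blast
    then have "\<alpha> (\<beta> v) = \<beta> v" using \<alpha>(3) LI by blast
    ultimately show ?thesis by (simp add: \<psi>_def)
  qed
  have onf: "\<psi> (f T) = g (h T)" if "T \<in> P" for T
  proof -
    have "g (h T) \<in> ?F" using that hQ by blast
    then have "\<beta> (g (h T)) = g (h T)" "\<alpha> (g (h T)) = g (h T)" using \<alpha>(3) \<beta>(3) F by blast+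
    then show ?thesis using \<gamma>(4)[OF that] by (simp add: \<psi>_def)
  qed
  have L: "\<psi> ` L = L" using onL \<alpha>(2) by simp
  have I: "\<psi> ` I = I" using onI \<beta>(2) by simp
  have X: "\<psi> ` verts H = verts H" by (simp add: verts_star L z)
  have "(`) \<psi> ` edges H = (\<lambda>x. {z, x}) ` \<psi> ` L"
    unfolding edges_star by (simp add: image_image z)
  then have E: "(`) \<psi> ` edges H = edges H" using L edges_star by simp
  have T: "\<psi> ` T = h T" if "T \<in> P" for T
  proof -
    have "x T \<in> L" "u T \<in> I" using xu(1,2) that by blast+
    then have "\<psi> ` {z, x T, u T} = {z, y (h T), w (h T)}"
      using z onL onI \<alpha>(4)[OF that] \<beta>(4)[OF that] by simp
    moreover have "h T \<in> Q" using hQ that by blast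
    ultimately show ?thesis using xu(5)[OF that] yw(5)[of "h T"] by metis
  qed
  show "starred ?G P f \<simeq>\<^sub>g starred ?G Q g"
  proof (rule starred_permute_iso(1)[OF b])
    show "\<psi> ` verts ?G = verts ?G" unfolding verts_join image_Un X I ..
    show "(`) \<psi> ` edges ?G = edges ?G" by (rule join_permute_edges[OF X E I])
    show "Q = (`) \<psi> ` P" using T hQ by simp
    show "g (\<psi> ` S) = \<psi> (f S)" if "S \<in> P" for S using T onf that by simp
  qed
qed

end

text \<open>A star has fewer edges than vertices, so \<open>card I\<close> may be too small to
  recognise \<open>H\<close> by degrees. Instead, with or without \<open>d\<close>, isomorphism
  amounts to packings of equal size.\<close>

lemma card_family_join_insert_star:
  assumes j: "star_join H I z L" and d: "d \<notin> verts H \<union> I"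
    and c: "7 \<le> card (verts H)" "4 \<le> card I" "card (edges H) \<le> card I"
  shows "card (family (join_indep H (insert d I))) = card (family (join_indep H I))"
proof -
  interpret I: star_join H I z L by (rule j)
  have "indep_join H (insert d I)" by (rule indep_join_insert[OF I.indep_join_axioms d])
  then interpret J: star_join H "insert d I" z L
    using j by (simp add: star_join_def)
  show ?thesis
  proof (rule card_family_join_insert[OF I.indep_join_axioms d c])
    fix P f Q g assume st: "(P, f) \<in> states H I d" "(Q, g) \<in> states H I d"
    let ?G = "join_indep H I" and ?G' = "join_indep H (insert d I)"
    have P: "packing ?G P" "labelling ?G P f" "packing ?G' P" "labelling ?G' P f"
      and Q: "packing ?G Q" "labelling ?G Q g" "packing ?G' Q" "labelling ?G' Q g"
      using st packing_join_mono[of H I _ "insert d I"] labelling_join_anti[of H "insert d I" _ _ I]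
      by (auto simp: states_def)
    show "starred ?G P f \<simeq>\<^sub>g starred ?G Q g \<longleftrightarrow> starred ?G' P f \<simeq>\<^sub>g starred ?G' Q g"
      using I.starred_star_iso_iff[OF P(1,2) Q(1,2)] J.starred_star_iso_iff[OF P(3,4) Q(3,4)] by simp
  qed
qed

section \<open>Complete multipartite graphs\<close>

abbreviation last_part :: "nat list \<Rightarrow> nat \<Rightarrow> (nat \<times> nat) set" where
  "last_part as N \<equiv> {length as} \<times> {..<N}"

lemma indep_join_multipartite: "indep_join (complete_multipartite as) (last_part as N)"
proof
  show "simple_graph (complete_multipartite as)" by (rule simple_graph_complete_multipartite)
  show "verts (complete_multipartite as) \<inter> last_part as N = {}"
    by (auto simp: complete_multipartite_def)
qed auto

lemma doubleton_in_edges_multipartite: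
  "{(i, j), (k, l)} \<in> edges (complete_multipartite as) \<longleftrightarrow>
    i < length as \<and> j < as ! i \<and> k < length as \<and> l < as ! k \<and> i \<noteq> k"
  unfolding complete_multipartite_def snd_conv mem_Collect_eq
  by (auto simp: doubleton_eq_iff)

text \<open>The appended part has index \<open>length as\<close>, so this is an equality of graphs
  and not merely an isomorphism.\<close>

lemma complete_multipartite_snoc:
  "complete_multipartite (as @ [N]) = join_indep (complete_multipartite as) (last_part as N)"
  (is "?K = ?J")
proof -
  interpret indep_join "complete_multipartite as" "last_part as N" by (rule indep_join_multipartite)
  have V: "verts ?K = verts ?J"
    by (auto simp: complete_multipartite_def nth_append less_Suc_eq)
  have mem: "(i, j) \<in> verts (complete_multipartite as) \<longleftrightarrow> i < length as \<and> j < as ! i" for i j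
    by (simp add: complete_multipartite_def)
  have J: "{x, y} \<in> edges ?J \<longleftrightarrow> {x, y} \<in> edges (complete_multipartite as) \<or>
      (x \<in> verts (complete_multipartite as) \<and> y \<in> last_part as N) \<or>
      (y \<in> verts (complete_multipartite as) \<and> x \<in> last_part as N)" for x y
    unfolding edges_join by (auto simp: doubleton_eq_iff)
  have E: "{x, y} \<in> edges ?K \<longleftrightarrow> {x, y} \<in> edges ?J" for x y
    unfolding J
    by (cases x; cases y)
      (auto simp: doubleton_in_edges_multipartite mem nth_append less_Suc_eq)
  have "s \<in> edges ?K \<longleftrightarrow> s \<in> edges ?J" for s
    using edge_doubletonE[OF simple_graph_complete_multipartite, of s "as @ [N]"]
      edge_doubletonE[OF simple_graph_join, of s] E by metis
  then show ?thesis using V by (simp add: prod_eq_iff set_eq_iff)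
qed

lemma card_verts_multipartite: "card (verts (complete_multipartite as)) = sum_list as"
proof (induction as rule: rev_induct)
  case Nil
  show ?case by (simp add: complete_multipartite_def)
next
  case (snoc N as)
  interpret indep_join "complete_multipartite as" "last_part as N" by (rule indep_join_multipartite)
  have "finite (verts (complete_multipartite as))" using simple by (simp add: simple_graph_def)
  then have "card (verts (complete_multipartite as) \<union> last_part as N) = sum_list as + N"
    using disj fin snoc by (subst card_Un_disjoint) (auto simp: card_cartesian_product)
  then show ?case by (simp add: complete_multipartite_snoc)
qed

lemma card_edges_multipartite_snoc:
  "card (edges (complete_multipartite (as @ [N]))) =
    card (edges (complete_multipartite as)) + sum_list as * N"
proof -
  let ?H = "complete_multipartite as"
  interpret indep_join ?H "last_part as N" by (rule indep_join_multipartite)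
  let ?E = "\<Union>u \<in> last_part as N. (\<lambda>x. {x, u}) ` verts ?H"
  have "?E = (\<lambda>(x, u). {x, u}) ` (verts ?H \<times> last_part as N)" by auto
  moreover have "inj_on (\<lambda>(x, u). {x, u}) (verts ?H \<times> last_part as N)"
    using disj by (auto simp: inj_on_def doubleton_eq_iff)
  ultimately have "card ?E = sum_list as * N"
    by (simp add: card_image card_cartesian_product card_verts_multipartite)
  moreover have "edges ?H \<inter> ?E = {}"
    using simple_graph_edgeD(2)[OF simple] disj by fastforce
  moreover have "finite ?E"
    using simple by (auto simp: simple_graph_def)
  ultimately show ?thesis
    unfolding complete_multipartite_snoc edges_join
    using finite_edges[OF simple] by (simp add: card_Un_disjoint)
qed

lemma edges_multipartite_single: "edges (complete_multipartite [k]) = {}"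
  by (auto simp: complete_multipartite_def)

lemma star_join_multipartite: "star_join (complete_multipartite [1, k]) I (0, 0) ({1} \<times> {..<k})"
  if "indep_join (complete_multipartite [1, k]) I"
proof -
  have K: "complete_multipartite [1, k] = join_indep (complete_multipartite [1]) ({1} \<times> {..<k})"
    using complete_multipartite_snoc[of "[1]" k] by simp
  have K1: "verts (complete_multipartite [1]) = {(0, 0)}" by (auto simp: complete_multipartite_def)
  have "edges (complete_multipartite [1, k]) = (\<lambda>x. {(0, 0), x}) ` ({1} \<times> {..<k})"
    unfolding K edges_join edges_multipartite_single K1 by auto
  moreover have "verts (complete_multipartite [1, k]) = insert (0, 0) ({1} \<times> {..<k})"
    unfolding K verts_join K1 by simp
  ultimately show ?thesis using that by (simp add: star_join_def star_join_axioms_def)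
qed

text \<open>With \<open>q\<close> vertices outside the last part of size \<open>b\<close>, there are
  at least \<open>q * b\<close> edges. This exceeds \<open>q + b\<close> unless one of the factors
  is 1.\<close>

lemma multipartite_star_or_dense:
  assumes "2 \<le> length as" "sorted as" "\<And>x. x \<in> set as \<Longrightarrow> 1 \<le> x" "7 \<le> sum_list as"
  shows "(\<exists>k. as = [1, k]) \<or> sum_list as < card (edges (complete_multipartite as))"
proof -
  obtain bs b where as: "as = bs @ [b]" using assms(1) by (cases as rule: rev_cases) auto
  then have "bs \<noteq> []" using assms(1) by auto
  then obtain cs c where bs: "bs = cs @ [c]" by (cases bs rule: rev_cases) auto
  define q where "q = sum_list bs"
  have cb: "1 \<le> c" "c \<le> b" using assms(2,3) unfolding as bs by (auto simp: sorted_append)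
  have qb: "7 \<le> q + b" using assms(4) unfolding as q_def by simp
  have qc: "q = sum_list cs + c" unfolding q_def bs by simp
  have e: "card (edges (complete_multipartite as)) =
      card (edges (complete_multipartite cs)) + sum_list cs * c + q * b"
    unfolding as q_def using card_edges_multipartite_snoc[of bs b] card_edges_multipartite_snoc[of cs c]
    unfolding bs by simp
  have sum: "sum_list as = q + b" by (simp add: as q_def)
  consider "q = 1" | "b = 1" | "2 \<le> q" "2 \<le> b" using cb qc by linarith
  then show ?thesis
  proof cases
    case 1
    then have "sum_list cs = 0" "c = 1" using cb qc by linarith+
    moreover have "cs = []"
    proof (rule ccontr)
      assume "cs \<noteq> []"
      then obtain x xs where "cs = x # xs" by (cases cs) auto
      then show False using \<open>sum_list cs = 0\<close> assms(3)[of x] unfolding as bs by auto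
    qed
    ultimately show ?thesis unfolding as bs by simp
  next
    case 2
    \<comment> \<open>Sortedness gives \<open>c = 1\<close>, so the last two parts alone contribute
      \<open>(q - 1) + q\<close> edges, which is more than \<open>q + 1\<close> since
      \<open>q\<close> is at least 6.\<close>
    then show ?thesis unfolding e sum using cb qc qb by auto
  next
    case 3
    \<comment> \<open>After the shift by 2, \<open>q * b\<close> exceeds \<open>q + b\<close> by
      \<open>p * r + p + r\<close>.\<close>
    then obtain p r where "q = p + 2" "b = r + 2" by (metis le_add_diff_inverse2)
    moreover from this qb have "3 \<le> p + r" by simp
    ultimately show ?thesis unfolding e sum by (auto simp: algebra_simps)
  qed
qed

section \<open>Induction on the size of the last part\<close>

lemma card_family_multipartite_Suc:
  assumes as: "2 \<le> length as" "sorted as" "\<And>x. x \<in> set as \<Longrightarrow> 1 \<le> x" "7 \<le> sum_list as"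
    and N: "card (edges (complete_multipartite as)) \<le> N"
  shows "card (family (complete_multipartite (as @ [Suc N]))) =
    card (family (complete_multipartite (as @ [N])))"
proof -
  let ?H = "complete_multipartite as" and ?I = "last_part as N" and ?d = "(length as, N)"
  have J: "last_part as (Suc N) = insert ?d ?I" by auto
  have d: "?d \<notin> verts ?H \<union> ?I" by (auto simp: complete_multipartite_def)
  have c: "7 \<le> card (verts ?H)" using as(4) by (simp add: card_verts_multipartite)
  have cI: "card ?I = N" by (simp add: card_cartesian_product)
  have "card (family (join_indep ?H (insert ?d ?I))) = card (family (join_indep ?H ?I))"
    using multipartite_star_or_dense[OF as]
  proof
    assume "\<exists>k. as = [1, k]"
    then obtain k where k: "as = [1, k]" by blast
    have "k = card (edges ?H)"
      using card_edges_multipartite_snoc[of "[1]" k] edges_multipartite_single[of 1] k by simp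
    then have "4 \<le> card ?I" using N cI as(4) k by simp
    moreover have "star_join ?H ?I (0, 0) ({1} \<times> {..<k})"
      using star_join_multipartite[of k ?I] indep_join_multipartite[of as N] k by simp
    ultimately show ?thesis using card_family_join_insert_star d c N cI by metis
  next
    assume "sum_list as < card (edges ?H)"
    then show ?thesis
      using N cI c d card_verts_multipartite[of as]
      by (intro card_family_join_insert_dense indep_join_multipartite) simp_all
  qed
  then show ?thesis unfolding complete_multipartite_snoc J .
qed

theorem theorem1:
  fixes n :: nat and a :: "nat \<Rightarrow> nat" and e :: nat
  assumes "n \<ge> 2"
    and "1 \<le> a 1"
    and "\<forall>i \<in> {1..<n}. a i \<le> a (i + 1)"
    and "e = card (edges (complete_multipartite (map a [1..<n])))"
    and "(\<Sum>i = 1..n - 1. a i) > 6"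
    and "a n \<ge> e"
  shows "card (family (complete_multipartite (map a [1..<n + 1]))) =
         card (family (complete_multipartite (map a [1..<n] @ [e])))"
proof -
  let ?as = "map a [1..<n]"
  have split: "map a [1..<n + 1] = ?as @ [a n]" using assms(1) by simp
  have mono: "a i \<le> a j" if "1 \<le> i" "i \<le> j" "j \<le> n" for i j
    using that(2,3)
  proof (induction rule: dec_induct)
    case (step k)
    then show ?case using assms(3) that(1) by (metis Suc_eq_plus1 Suc_le_lessD atLeastLessThan_iff
      le_trans less_imp_le)
  qed simp
  have "sum_list ?as = (\<Sum>i \<in> {1..<n}. a i)" by (simp add: sum_list_distinct_conv_sum_set)
  also have "{1..<n} = {1..n - 1}" using assms(1) by auto
  finally have sum: "7 \<le> sum_list ?as" using assms(5) by simp
  show ?thesis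
  proof (cases "n = 2")
    case True
    \<comment> \<open>A single remaining part has no edges, so \<open>e = 0\<close> and the graph on
      the right has an empty last part; both families consist of one class.\<close>
    then have as: "?as = [a 1]" by (simp add: upt_rec)
    have e0: "e = 0" unfolding assms(4) as edges_multipartite_single by simp
    have "7 \<le> a 1" using sum as by simp
    moreover from this have "4 \<le> a n" using mono[of 1 n] True by simp
    moreover have "card (family (complete_multipartite ([a 1] @ [N]))) = 1" if "4 \<le> N \<or> N = 0" for N
      unfolding complete_multipartite_snoc
      using that \<open>7 \<le> a 1\<close> card_verts_multipartite[of "[a 1]"]
      by (intro indep_join.card_family_join_edgeless indep_join_multipartite edges_multipartite_single)
        (auto simp: card_cartesian_product)
    ultimately show ?thesis unfolding split as e0 by simp
  next
    case False
    then have len: "2 \<le> length ?as" using assms(1) by simp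
    have sorted: "sorted ?as"
      using mono by (auto simp: sorted_iff_nth_mono)
    have pos: "1 \<le> x" if "x \<in> set ?as" for x
      using that mono[of 1] assms(2) by (force intro: le_trans)
    \<comment> \<open>The last part grows from \<open>e\<close> to \<open>a n\<close> one vertex at
      a time.\<close>
    have "card (family (complete_multipartite (?as @ [e + k]))) =
        card (family (complete_multipartite (?as @ [e])))" for k
    proof (induction k)
      case (Suc k)
      then show ?case
        using card_family_multipartite_Suc[OF len sorted pos sum, of "e + k"] assms(4) by simp
    qed simp
    from this[of "a n - e"] show ?thesis unfolding split using assms(6) by simp
  qed
qed

end
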